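(* Let $D=(V(D),E(D),w)$ be a vertex-weighted rooted forest such that $w(x)\geq 2$ for every vertex $x$ of $D$. Then $$\operatorname{reg}(I(D))=\sum_{x\in V(D)}w(x)-|E(D)|+1.$$
   Context: A vertex-weighted oriented graph is a triple $D=(V(D),E(D),w)$, where $V(D)=\{x_1,\dots,x_n\}$ is a finite vertex set, $E(D)$ is a set of ordered pairs of distinct vertices such that each pair of vertices is joined by at most one edge, in only one direction, and $w:V(D)\to\{1,2,\ldots\}$ is a weight function. An edge written $uv$ is directed from its starting point $u$ to its ending point $v$. A rooted tree is an oriented graph obtained by orienting the edges of an undirected tree so that all edges are oriented away from a fixed vertex, the root. A rooted forest is a disjoint union of rooted trees. Put $w_j=w(x_j)$. Let $k$ be a field and $S=k[x_1,\ldots,x_n]$ with the standard grading. The edge ideal of $D$ is the ideal $I(D)=(x_ix_j^{w_j}\mid x_ix_j\in E(D))\subset S$, where $x_ix_j\in E(D)$ is directed from $x_i$ to $x_j$. For a homogeneous ideal $I\subset S$ with graded Betti numbers $\beta_{i,j}(I)$ of $I$ as an $S$-module (so $\beta_{0,j}(I)$ is the number of minimal generators of degree $j$), $\operatorname{reg}(I)=\max\{j-i\mid\beta_{i,j}(I)\neq 0\}$.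
   Formalization: As stated the formula fails: one edge xy with both weights 2 has I(D)=(xy^2), reg 3, not 4. Proved instead: every root (source) has weight 1, every other vertex has weight at least 2, and D has at least one vertex and no isolated vertices. *)

theory Defs
  imports
    "HOL-Library.Poly_Mapping"
    "HOL-Library.Disjoint_Sets"
    "Jordan_Normal_Form.Matrix_Kernel"
begin

section \<open>Vertex-weighted oriented graphs and rooted forests\<close>

text \<open>
  The vertex set is the whole of a finite type, and an edge directed from \<open>u\<close> to \<open>v\<close> is the
  pair \<open>(u, v)\<close>.
\<close>

definition oriented_graph :: "('v \<times> 'v) set \<Rightarrow> bool" where
  "oriented_graph E \<longleftrightarrow> (\<forall>(u, v) \<in> E. u \<noteq> v \<and> (v, u) \<notin> E)"

definition weighted_oriented_graph :: "('v \<times> 'v) set \<Rightarrow> ('v \<Rightarrow> nat) \<Rightarrow> bool" where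
  "weighted_oriented_graph E w \<longleftrightarrow> oriented_graph E \<and> (\<forall>x. 1 \<le> w x)"

text \<open>
  The weight of a source occurs in no generator of the edge ideal.  The usual convention for
  weighted oriented graphs is that sources have weight \<open>1\<close> and that there are no isolated
  vertices.  It is not part of \<open>weighted_oriented_graph\<close>; where it is needed it is an explicit
  hypothesis.  It matters for every formula that sums the weights over all vertices.
\<close>

definition source :: "('v \<times> 'v) set \<Rightarrow> 'v \<Rightarrow> bool" where
  "source E x \<longleftrightarrow> (\<forall>y. (y, x) \<notin> E)"

definition isolated :: "('v \<times> 'v) set \<Rightarrow> 'v \<Rightarrow> bool" where
  "isolated E x \<longleftrightarrow> (\<forall>y. (x, y) \<notin> E \<and> (y, x) \<notin> E)"

definition adjacent :: "('v \<times> 'v) set \<Rightarrow> 'v \<Rightarrow> 'v \<Rightarrow> bool" where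
  "adjacent E u v \<longleftrightarrow> (u, v) \<in> E \<or> (v, u) \<in> E"

text \<open>
  Paths and cycles of the underlying undirected graph.  (The predicates \<open>forest\<close> and \<open>tree\<close> of
  the AFP entry Graph Theory exclude directed cycles only, so they do not describe undirected trees.)
\<close>

definition undirected_path :: "('v \<times> 'v) set \<Rightarrow> 'v list \<Rightarrow> bool" where
  "undirected_path E p \<longleftrightarrow> p \<noteq> [] \<and> distinct p \<and> successively (adjacent E) p"

definition undirected_cycle :: "('v \<times> 'v) set \<Rightarrow> 'v list \<Rightarrow> bool" where
  "undirected_cycle E p \<longleftrightarrow>
     3 \<le> length p \<and> undirected_path E p \<and> adjacent E (last p) (hd p)"

definition undirected_tree :: "'v set \<Rightarrow> ('v \<times> 'v) set \<Rightarrow> bool" where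
  "undirected_tree V E \<longleftrightarrow>
     V \<noteq> {} \<and> E \<subseteq> V \<times> V \<and>
     (\<forall>u\<in>V. \<forall>v\<in>V. \<exists>p. undirected_path E p \<and> hd p = u \<and> last p = v) \<and>
     (\<nexists>p. undirected_cycle E p)"

text \<open>
  All edges are oriented away from the root: every path that starts at the root follows the
  direction of the edges it uses.
\<close>

definition rooted_tree :: "'v set \<Rightarrow> ('v \<times> 'v) set \<Rightarrow> bool" where
  "rooted_tree V E \<longleftrightarrow>
     oriented_graph E \<and> undirected_tree V E \<and>
     (\<exists>r\<in>V. \<forall>p. undirected_path E p \<and> hd p = r \<longrightarrow> successively (\<lambda>u v. (u, v) \<in> E) p)"

definition rooted_forest :: "('v \<times> 'v) set \<Rightarrow> bool" where
  "rooted_forest E \<longleftrightarrow>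
     (\<exists>P. partition_on UNIV P \<and>
          (\<forall>(u, v) \<in> E. \<exists>C\<in>P. u \<in> C \<and> v \<in> C) \<and>
          (\<forall>C\<in>P. rooted_tree C (E \<inter> C \<times> C)))"


section \<open>The polynomial ring and edge ideals\<close>

text \<open>
  \<open>('v, 'k) mpoly\<close> is the polynomial ring over \<open>'k\<close> with one variable for each element of \<open>'v\<close>:
  a polynomial maps exponent vectors to coefficients.
\<close>

type_synonym ('v, 'k) mpoly = "('v \<Rightarrow>\<^sub>0 nat) \<Rightarrow>\<^sub>0 'k"

definition var :: "'v \<Rightarrow> ('v, 'k::comm_ring_1) mpoly" where
  "var x = Poly_Mapping.single (Poly_Mapping.single x 1) 1"

definition monom_degree :: "('v \<Rightarrow>\<^sub>0 nat) \<Rightarrow> nat" where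
  "monom_degree m = (\<Sum>x\<in>Poly_Mapping.keys m. Poly_Mapping.lookup m x)"

text \<open>The ideal generated by a set is its span in the ring regarded as a module over itself.\<close>

definition edge_ideal :: "('v \<times> 'v) set \<Rightarrow> ('v \<Rightarrow> nat) \<Rightarrow> ('v, 'k::field) mpoly set" where
  "edge_ideal E w = module.span (*) {var u * var v ^ w v | u v. (u, v) \<in> E}"


section \<open>Minimal graded free resolutions, graded Betti numbers, regularity\<close>

text \<open>
  A graded free resolution
  \<open>\<dots> \<longrightarrow> F 2 \<longrightarrow> F 1 \<longrightarrow> F 0 \<longrightarrow> I \<longrightarrow> 0\<close>
  of an ideal \<open>I\<close> of \<open>S\<close> is given by the lists \<open>d i\<close> of the degrees of a homogeneous basis of
  \<open>F i\<close>, that is, \<open>F i\<close> is the direct sum of the modules \<open>S(-a)\<close> for \<open>a\<close> in the list \<open>d i\<close>, and by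
  matrices: \<open>A 0\<close> is the matrix with one row of \<open>F 0 \<longrightarrow> I \<subseteq> S\<close>, and \<open>A (Suc i)\<close> is the matrix
  of \<open>F (Suc i) \<longrightarrow> F i\<close>.  The list \<open>target_degrees d i\<close> belongs to the target of \<open>A i\<close>; for
  \<open>i = 0\<close> this is \<open>S\<close> itself, with its basis element in degree \<open>0\<close>.
\<close>

fun target_degrees :: "(nat \<Rightarrow> nat list) \<Rightarrow> nat \<Rightarrow> nat list" where
  "target_degrees d 0 = [0]"
| "target_degrees d (Suc i) = d i"

text \<open>
  The third clause says that the maps are homogeneous of degree \<open>0\<close>: the entry in row \<open>r\<close> and
  column \<open>c\<close> is a form whose degree is the difference of the degrees of the two basis elements
  (in particular it is \<open>0\<close> if this difference is negative).
\<close>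

definition graded_free_resolution ::
  "(nat \<Rightarrow> nat list) \<Rightarrow> (nat \<Rightarrow> ('v, 'k::field) mpoly mat) \<Rightarrow> ('v, 'k) mpoly set \<Rightarrow> bool" where
  "graded_free_resolution d A I \<longleftrightarrow>
     (\<forall>i. A i \<in> carrier_mat (length (target_degrees d i)) (length (d i))) \<and>
     I = {(A 0 *\<^sub>v v) $ 0 | v. v \<in> carrier_vec (length (d 0))} \<and>
     (\<forall>i. \<forall>r < length (target_degrees d i). \<forall>c < length (d i).
        \<forall>m \<in> Poly_Mapping.keys (A i $$ (r, c)).
          monom_degree m + target_degrees d i ! r = d i ! c) \<and>
     (\<forall>i. mat_kernel (A i) = {A (Suc i) *\<^sub>v v | v. v \<in> carrier_vec (length (d (Suc i)))})"

text \<open>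
  Minimality: the matrices of \<open>F (Suc i) \<longrightarrow> F i\<close> have all their entries in the ideal generated
  by the variables, that is, these entries have constant coefficient \<open>0\<close>.
\<close>

definition minimal_graded_free_resolution ::
  "(nat \<Rightarrow> nat list) \<Rightarrow> (nat \<Rightarrow> ('v, 'k::field) mpoly mat) \<Rightarrow> ('v, 'k) mpoly set \<Rightarrow> bool" where
  "minimal_graded_free_resolution d A I \<longleftrightarrow>
     graded_free_resolution d A I \<and>
     (\<forall>i. \<forall>r < length (d i). \<forall>c < length (d (Suc i)).
        Poly_Mapping.lookup (A (Suc i) $$ (r, c)) 0 = 0)"

text \<open>
  For a homogeneous ideal, a minimal graded free resolution exists and is unique up to isomorphism,
  so that the following description is proper.
\<close>

definition graded_betti :: "('v, 'k::field) mpoly set \<Rightarrow> nat \<Rightarrow> nat \<Rightarrow> nat" where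
  "graded_betti I i j =
     (THE b. \<exists>d A. minimal_graded_free_resolution d A I \<and> b = count_list (d i) j)"

definition regularity :: "('v, 'k::field) mpoly set \<Rightarrow> int" where
  "regularity I = Max {int j - int i | i j. graded_betti I i j \<noteq> 0}"

end

theory Submission
  imports Defs
begin

text \<open>
  The edge ideal has one generator \<open>x\<^sub>u x\<^sub>v\<^bsup>w v\<^esup>\<close> for each edge \<open>uv\<close>.  In a rooted forest a vertex has at most one
  parent (\<open>rooted_forest_parent_unique\<close>), so that the generators belong to different end points \<open>v\<close>.
  All end points have weight at least \<open>2\<close>, while \<open>x\<^sub>v\<close> occurs with exponent at most \<open>1\<close> in every
  other generator.  Hence removing one generator from a set of generators always makes the least common
  multiple strictly smaller.  This is exactly the condition under which the Taylor resolution of a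
  monomial ideal is minimal (\<open>taylor_resolution_minimal\<close>).

  The graded Betti numbers can therefore be read off: each nonempty set \<open>T\<close> of generators contributes one
  basis element, of homological degree \<open>card T - 1\<close> and of degree \<open>deg lcm T\<close>.  So the regularity is the
  maximum of \<open>deg lcm T - card T + 1\<close> over all nonempty \<open>T\<close> (\<open>regularity_taylor\<close>).  Adding an edge to \<open>T\<close>
  raises the exponent at its end point from at most \<open>1\<close> to at least \<open>2\<close>, so that the maximum is attained
  by the set of all edges.  Its least common multiple has the exponent \<open>w x\<close> at every vertex \<open>x\<close>; at a
  source this holds because a source starts an edge and has weight \<open>1\<close>.

  Two general facts carry this argument.  The Taylor complex is exact (\<open>taylor_exact\<close>): in each
  multidegree it is the augmented chain complex of a full simplex, which is contracted by a cone.  The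
  degrees in a minimal graded free resolution do not depend on the resolution
  (\<open>minimal_resolution_degrees_unique\<close>): comparison maps between two minimal resolutions are mutually inverse
  up to homotopy, and homotopies vanish modulo the variables.
\<close>

section \<open>Coefficients and degrees in the polynomial ring\<close>

lemma lookup_single_times_add:
  fixes p :: "'a::cancel_comm_monoid_add \<Rightarrow>\<^sub>0 'k::semiring_0"
  shows "Poly_Mapping.lookup (Poly_Mapping.single a c * p) (a + b) = c * Poly_Mapping.lookup p b"
  by (simp add: lookup_mult lookup_single when_mult)

lemma lookup_single_times_eq_0:
  fixes p :: "'a::cancel_comm_monoid_add \<Rightarrow>\<^sub>0 'k::semiring_0"
  assumes "\<And>b. d \<noteq> a + b"
  shows "Poly_Mapping.lookup (Poly_Mapping.single a c * p) d = 0"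
  using assms by (simp add: lookup_mult lookup_single when_mult)

lemma exponent_add_eq_0_iff:
  fixes a b :: "'v \<Rightarrow>\<^sub>0 nat"
  shows "a + b = 0 \<longleftrightarrow> a = 0 \<and> b = 0"
  by (auto simp: poly_mapping_eq_iff fun_eq_iff lookup_add)

lemma const_coeff_times:
  fixes p q :: "('v, 'k::comm_ring_1) mpoly"
  shows "Poly_Mapping.lookup (p * q) 0 = Poly_Mapping.lookup p 0 * Poly_Mapping.lookup q 0"
proof -
  have "(Poly_Mapping.lookup q b when 0 = a + b) = ((Poly_Mapping.lookup q b when 0 = b) when 0 = a)" for a b
    by (auto simp: exponent_add_eq_0_iff when_def eq_commute[of 0])
  then show ?thesis
    by (simp add: lookup_mult mult_when Sum_any_when_independent)
qed

lemma monom_degree_add: "monom_degree (a + b) = monom_degree a + monom_degree b"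
proof -
  let ?K = "Poly_Mapping.keys a \<union> Poly_Mapping.keys b"
  have "monom_degree m = sum (Poly_Mapping.lookup m) ?K" if "Poly_Mapping.keys m \<subseteq> ?K" for m
    unfolding monom_degree_def using that
    by (intro sum.mono_neutral_left) (auto simp: in_keys_iff)
  then show ?thesis
    using keys_add[of a b] by (simp add: lookup_add sum.distrib)
qed

lemma monom_degree_UNIV:
  fixes m :: "'v::finite \<Rightarrow>\<^sub>0 nat"
  shows "monom_degree m = (\<Sum>x\<in>UNIV. Poly_Mapping.lookup m x)"
  unfolding monom_degree_def by (intro sum.mono_neutral_left) (auto simp: in_keys_iff)

lemma monom_degree_0 [simp]: "monom_degree 0 = 0"
  by (simp add: monom_degree_def)

text \<open>
  The component of degree \<open>t - s\<close>.  The two arguments are the degrees of the basis elements to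
  which a row and a column of a homogeneous matrix belong; adding \<open>s\<close> instead of subtracting it
  makes the component vanish for \<open>t < s\<close>, where truncated subtraction would select the constants.
\<close>

lift_definition degree_part :: "nat \<Rightarrow> nat \<Rightarrow> ('v, 'k::zero) mpoly \<Rightarrow> ('v, 'k) mpoly"
  is "\<lambda>s t f m. if monom_degree m + s = t then f m else 0"
  by (rule finite_subset[rotated]) auto

lemma degree_part_add: "degree_part s t (p + q) = degree_part s t p + degree_part s t q"
  by (rule poly_mapping_eqI) (simp add: degree_part.rep_eq lookup_add)

lemma degree_part_0 [simp]: "degree_part s t 0 = 0"
  by (rule poly_mapping_eqI) (simp add: degree_part.rep_eq)

lemma degree_part_sum: "degree_part s t (sum f X) = (\<Sum>x\<in>X. degree_part s t (f x))"
  by (induction X rule: infinite_finite_induct) (simp_all add: degree_part_add)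

lemma degree_part_single:
  "degree_part s t (Poly_Mapping.single m c) = (if monom_degree m + s = t then Poly_Mapping.single m c else 0)"
  by (rule poly_mapping_eqI) (auto simp: degree_part.rep_eq lookup_single when_def)

lemma degree_part_homogeneous:
  assumes "\<And>m. m \<in> Poly_Mapping.keys p \<Longrightarrow> monom_degree m + s = t"
  shows "degree_part s t p = p"
  using assms by (intro poly_mapping_eqI) (auto simp: degree_part.rep_eq in_keys_iff)

lemma poly_mapping_sum_singles:
  "p = (\<Sum>m\<in>Poly_Mapping.keys p. Poly_Mapping.single m (Poly_Mapping.lookup p m))"
proof (rule poly_mapping_eqI)
  fix k
  show "Poly_Mapping.lookup p k
      = Poly_Mapping.lookup (\<Sum>m\<in>Poly_Mapping.keys p. Poly_Mapping.single m (Poly_Mapping.lookup p m)) k"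
    by (simp add: lookup_sum lookup_single when_def in_keys_iff)
qed

text \<open>
  The product of a form of degree \<open>r - s\<close> and a component of degree \<open>t - r\<close> has degree \<open>t - s\<close>.
  If \<open>r < s\<close>, then \<open>a\<close> is \<open>0\<close>.
\<close>

lemma degree_part_times:
  fixes a p :: "('v, 'k::comm_ring_1) mpoly"
  assumes "\<And>m. m \<in> Poly_Mapping.keys a \<Longrightarrow> monom_degree m + s = r"
  shows "degree_part s t (a * p) = a * degree_part r t p"
proof -
  have single: "degree_part s t (Poly_Mapping.single m c * Poly_Mapping.single n e)
      = Poly_Mapping.single m c * degree_part r t (Poly_Mapping.single n e)"
    if "m \<in> Poly_Mapping.keys a" for m n c e
    using assms[OF that] by (auto simp: mult_single degree_part_single monom_degree_add)
  have "degree_part s t (a * p) = (\<Sum>m\<in>Poly_Mapping.keys a. \<Sum>n\<in>Poly_Mapping.keys p.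
      degree_part s t (Poly_Mapping.single m (Poly_Mapping.lookup a m) * Poly_Mapping.single n (Poly_Mapping.lookup p n)))"
    by (subst poly_mapping_sum_singles[of a], subst poly_mapping_sum_singles[of p])
       (simp only: sum_product degree_part_sum)
  also have "\<dots> = (\<Sum>m\<in>Poly_Mapping.keys a. \<Sum>n\<in>Poly_Mapping.keys p.
      Poly_Mapping.single m (Poly_Mapping.lookup a m) * degree_part r t (Poly_Mapping.single n (Poly_Mapping.lookup p n)))"
    by (intro sum.cong refl single)
  also have "\<dots> = (\<Sum>m\<in>Poly_Mapping.keys a. Poly_Mapping.single m (Poly_Mapping.lookup a m))
      * degree_part r t (\<Sum>n\<in>Poly_Mapping.keys p. Poly_Mapping.single n (Poly_Mapping.lookup p n))"
    by (simp add: sum_product degree_part_sum)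
  finally show ?thesis
    by (simp flip: poly_mapping_sum_singles)
qed

section \<open>Homogeneous matrices\<close>

definition homogeneous_matrix :: "nat list \<Rightarrow> nat list \<Rightarrow> ('v, 'k::zero) mpoly mat \<Rightarrow> bool" where
  "homogeneous_matrix rs cs A \<longleftrightarrow>
     A \<in> carrier_mat (length rs) (length cs) \<and>
     (\<forall>r < length rs. \<forall>c < length cs. \<forall>m \<in> Poly_Mapping.keys (A $$ (r, c)).
        monom_degree m + rs ! r = cs ! c)"

definition mat_range :: "'a::semiring_0 mat \<Rightarrow> 'a vec set" where
  "mat_range A = {A *\<^sub>v v | v. v \<in> carrier_vec (dim_col A)}"

lemma homogeneous_matrix_carrier:
  "homogeneous_matrix rs cs A \<Longrightarrow> A \<in> carrier_mat (length rs) (length cs)"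
  by (simp add: homogeneous_matrix_def)

lemma index_mult_mat_sum:
  assumes "A \<in> carrier_mat n k" "B \<in> carrier_mat k l" "i < n" "j < l"
  shows "(A * B) $$ (i, j) = (\<Sum>r<k. A $$ (i, r) * B $$ (r, j))"
  using assms by (simp add: scalar_prod_def atLeast0LessThan)

lemma homogeneous_matrix_mult:
  fixes A B :: "('v, 'k::comm_ring_1) mpoly mat"
  assumes "homogeneous_matrix rs cs A" "homogeneous_matrix cs ds B"
  shows "homogeneous_matrix rs ds (A * B)"
proof -
  note car = assms[THEN homogeneous_matrix_carrier]
  have "monom_degree m + rs ! r = ds ! d"
    if r: "r < length rs" and d: "d < length ds" and m: "m \<in> Poly_Mapping.keys ((A * B) $$ (r, d))" for r d m
  proof -
    have "m \<in> Poly_Mapping.keys (\<Sum>c<length cs. A $$ (r, c) * B $$ (c, d))"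
      using m index_mult_mat_sum[OF car r d] by simp
    then obtain c where c: "c < length cs" "m \<in> Poly_Mapping.keys (A $$ (r, c) * B $$ (c, d))"
      using keys_sum[of "\<lambda>c. A $$ (r, c) * B $$ (c, d)" "{..<length cs}"] by auto
    then obtain a b where "m = a + b" "a \<in> Poly_Mapping.keys (A $$ (r, c))" "b \<in> Poly_Mapping.keys (B $$ (c, d))"
      using keys_mult[of "A $$ (r, c)" "B $$ (c, d)"] by auto
    then show ?thesis
      using assms r c d unfolding homogeneous_matrix_def by (force simp: monom_degree_add)
  qed
  then show ?thesis
    using car by (auto simp: homogeneous_matrix_def)
qed

text \<open>
  A lift exists column by column because the columns of \<open>B\<close> lie in the range of \<open>A\<close>.  Replacing each
  entry of the lift by its component of the right degree does not change the product, since the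
  entries of \<open>A\<close> and \<open>B\<close> are forms of the right degrees.
\<close>

lemma homogeneous_lift:
  fixes A B :: "('v, 'k::comm_ring_1) mpoly mat"
  assumes A: "homogeneous_matrix rs cs A" and B: "homogeneous_matrix rs ds B"
    and range: "\<And>d. d < length ds \<Longrightarrow> col B d \<in> mat_range A"
  obtains X where "homogeneous_matrix cs ds X" "A * X = B"
proof -
  note carA = homogeneous_matrix_carrier[OF A] and carB = homogeneous_matrix_carrier[OF B]
  have "\<forall>d\<in>{..<length ds}. \<exists>v. v \<in> carrier_vec (length cs) \<and> col B d = A *\<^sub>v v"
    using range carA unfolding mat_range_def by fastforce
  then obtain v where v: "\<And>d. d < length ds \<Longrightarrow> v d \<in> carrier_vec (length cs)"
      "\<And>d. d < length ds \<Longrightarrow> col B d = A *\<^sub>v v d"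
    by (metis lessThan_iff)
  define X where "X = mat (length cs) (length ds) (\<lambda>(c, d). degree_part (cs ! c) (ds ! d) (v d $ c))"
  have carX: "X \<in> carrier_mat (length cs) (length ds)" by (simp add: X_def)
  have "homogeneous_matrix cs ds X"
    by (auto simp: homogeneous_matrix_def X_def in_keys_iff degree_part.rep_eq split: if_splits)
  moreover have "A * X = B"
  proof (rule eq_matI)
    fix r d assume "r < dim_row B" "d < dim_col B"
    then have r: "r < length rs" and d: "d < length ds" using carB by auto
    have "B $$ (r, d) = col B d $ r" using r d carB by simp
    also have "\<dots> = (\<Sum>c<length cs. A $$ (r, c) * v d $ c)"
      using v[OF d] carA r by (simp add: scalar_prod_def atLeast0LessThan)
    finally have Brd: "B $$ (r, d) = (\<Sum>c<length cs. A $$ (r, c) * v d $ c)" .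
    have "(A * X) $$ (r, d) = (\<Sum>c<length cs. A $$ (r, c) * degree_part (cs ! c) (ds ! d) (v d $ c))"
      unfolding index_mult_mat_sum[OF carA carX r d] using d by (intro sum.cong) (auto simp: X_def)
    also have "\<dots> = (\<Sum>c<length cs. degree_part (rs ! r) (ds ! d) (A $$ (r, c) * v d $ c))"
      using A r by (intro sum.cong refl degree_part_times[symmetric]) (auto simp: homogeneous_matrix_def)
    also have "\<dots> = degree_part (rs ! r) (ds ! d) (B $$ (r, d))"
      by (simp add: Brd degree_part_sum)
    also have "\<dots> = B $$ (r, d)"
      using B r d by (intro degree_part_homogeneous) (auto simp: homogeneous_matrix_def)
    finally show "(A * X) $$ (r, d) = B $$ (r, d)" .
  qed (use carA carX carB in auto)
  ultimately show ?thesis using that by blast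
qed

text \<open>
  Reduction modulo the ideal generated by the variables.
\<close>

definition const_matrix :: "('v, 'k::zero) mpoly mat \<Rightarrow> 'k mat" where
  "const_matrix A = map_mat (\<lambda>p. Poly_Mapping.lookup p 0) A"

lemma const_matrix_mult:
  fixes A B :: "('v, 'k::comm_ring_1) mpoly mat"
  assumes "A \<in> carrier_mat n k" "B \<in> carrier_mat k l"
  shows "const_matrix (A * B) = const_matrix A * const_matrix B"
  using assms
  by (intro eq_matI) (auto simp: const_matrix_def scalar_prod_def lookup_sum const_coeff_times)

lemma card_le_of_one_sided_inverse:
  fixes p q :: "nat \<Rightarrow> nat \<Rightarrow> 'k::field"
  assumes R: "finite R" and C: "finite C"
    and pq: "\<And>r s. r \<in> R \<Longrightarrow> s \<in> R \<Longrightarrow> (\<Sum>c\<in>C. p r c * q c s) = (if r = s then 1 else 0)"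
  shows "card R \<le> card C"
proof (rule ccontr)
  assume less: "\<not> card R \<le> card C"
  define n where "n = card R"
  obtain f g where f: "bij_betw f {..<n} R" and g: "bij_betw g {..<card C} C"
    using R C by (metis n_def atLeast0LessThan ex_bij_betw_nat_finite)
  \<comment> \<open>Padding with zeros makes both matrices square, where a left inverse is also a right inverse.\<close>
  define P where "P = mat n n (\<lambda>(i, j). if j < card C then p (f i) (g j) else 0)"
  define Q where "Q = mat n n (\<lambda>(i, j). if i < card C then q (g i) (f j) else 0)"
  have car: "P \<in> carrier_mat n n" "Q \<in> carrier_mat n n" by (simp_all add: P_def Q_def)
  have "P * Q = 1\<^sub>m n"
  proof (rule eq_matI)
    fix i j assume "i < dim_row (1\<^sub>m n :: 'k mat)" "j < dim_col (1\<^sub>m n :: 'k mat)"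
    then have ij: "i < n" "j < n" by auto
    have "(P * Q) $$ (i, j) = (\<Sum>l<n. if l < card C then p (f i) (g l) * q (g l) (f j) else 0)"
      unfolding index_mult_mat_sum[OF car ij] using ij by (intro sum.cong) (auto simp: P_def Q_def)
    also have "\<dots> = (\<Sum>l<card C. p (f i) (g l) * q (g l) (f j))"
      using less by (intro sum.mono_neutral_cong_right) (auto simp: n_def)
    also have "\<dots> = (\<Sum>c\<in>C. p (f i) c * q c (f j))"
      by (rule sum.reindex_bij_betw[OF g])
    also have "\<dots> = (if i = j then 1 else 0)"
      using pq[of "f i" "f j"] bij_betwE[OF f] ij bij_betw_imp_inj_on[OF f]
      by (auto simp: inj_on_def)
    finally show "(P * Q) $$ (i, j) = 1\<^sub>m n $$ (i, j)" using ij by simp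
  qed (use car in auto)
  then have QP: "Q * P = 1\<^sub>m n" using mat_mult_left_right_inverse[OF car] by blast
  have l: "card C < n" using less by (simp add: n_def)
  have "(Q * P) $$ (card C, card C) = 0"
    unfolding index_mult_mat_sum[OF car(2,1) l l] using l by (intro sum.neutral) (auto simp: Q_def)
  then show False using QP l by simp
qed

text \<open>
  An entry of a homogeneous matrix can have a constant term only if its row and its column have
  the same degree.  So the reduction of \<open>P\<close> is block diagonal with respect to the degrees, and
  each block inherits the one-sided inverse.
\<close>

lemma degree_counts_le:
  fixes P Q :: "('v, 'k::field) mpoly mat"
  assumes P: "homogeneous_matrix rs cs P" and Q: "homogeneous_matrix cs rs Q"
    and inv: "const_matrix (P * Q) = 1\<^sub>m (length rs)"
  shows "count_list rs j \<le> count_list cs j"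
proof -
  note carP = homogeneous_matrix_carrier[OF P] and carQ = homogeneous_matrix_carrier[OF Q]
  define R where "R = {r. r < length rs \<and> rs ! r = j}"
  define C where "C = {c. c < length cs \<and> cs ! c = j}"
  define p where "p = (\<lambda>r c. Poly_Mapping.lookup (P $$ (r, c)) 0)"
  define q where "q = (\<lambda>c r. Poly_Mapping.lookup (Q $$ (c, r)) 0)"
  have off_block: "p r c = 0" if "r \<in> R" "c < length cs" "c \<notin> C" for r c
  proof (rule ccontr)
    assume "p r c \<noteq> 0"
    then have "0 \<in> Poly_Mapping.keys (P $$ (r, c))" by (simp add: p_def in_keys_iff)
    then have "rs ! r = cs ! c"
      using P that unfolding homogeneous_matrix_def R_def by fastforce
    then show False using that by (simp add: R_def C_def)
  qed
  have "(\<Sum>c\<in>C. p r c * q c s) = (if r = s then 1 else 0)" if r: "r \<in> R" and s: "s \<in> R" for r s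
  proof -
    have rs: "r < length rs" "s < length rs" using r s by (auto simp: R_def)
    have "(\<Sum>c\<in>C. p r c * q c s) = (\<Sum>c<length cs. p r c * q c s)"
      using off_block[OF r] by (intro sum.mono_neutral_left) (auto simp: C_def)
    also have "\<dots> = const_matrix (P * Q) $$ (r, s)"
      using rs carP carQ index_mult_mat_sum[OF carP carQ rs]
      by (simp add: const_matrix_def lookup_sum const_coeff_times p_def q_def)
    finally show ?thesis using inv rs by simp
  qed
  then have "card R \<le> card C"
    by (intro card_le_of_one_sided_inverse[of R C p q]) (auto simp: R_def C_def)
  then show ?thesis
    by (simp add: R_def C_def count_list_eq_length_filter length_filter_conv_card eq_commute conj_commute)
qed

section \<open>Uniqueness of graded Betti numbers\<close>

lemma graded_free_resolutionD:
  fixes A :: "nat \<Rightarrow> ('v, 'k::field) mpoly mat"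
  assumes "graded_free_resolution d A I"
  shows "homogeneous_matrix (target_degrees d i) (target_degrees d (Suc i)) (A i)"
    and "I = (\<lambda>v. v $ 0) ` mat_range (A 0)"
    and "mat_kernel (A i) = mat_range (A (Suc i))"
proof -
  have car: "A i \<in> carrier_mat (length (target_degrees d i)) (length (d i))" for i
    using assms unfolding graded_free_resolution_def by blast
  show "homogeneous_matrix (target_degrees d i) (target_degrees d (Suc i)) (A i)"
    using assms unfolding graded_free_resolution_def homogeneous_matrix_def by simp
  have "I = {(A 0 *\<^sub>v v) $ 0 | v. v \<in> carrier_vec (length (d 0))}"
    using assms unfolding graded_free_resolution_def by blast
  then show "I = (\<lambda>v. v $ 0) ` mat_range (A 0)"
    using car[of 0] unfolding mat_range_def by (simp only: setcompr_eq_image image_image) auto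
  show "mat_kernel (A i) = mat_range (A (Suc i))"
    using assms car[of "Suc i"] unfolding graded_free_resolution_def mat_range_def by auto
qed


lemma col_in_mat_range:
  fixes A :: "'a::comm_ring_1 mat"
  assumes "c < dim_col A"
  shows "col A c \<in> mat_range A"
proof -
  have "col A c = A *\<^sub>v unit_vec (dim_col A) c"
    using assms by (intro eq_vecI) auto
  then show ?thesis unfolding mat_range_def by auto
qed

lemma mult_eq_0_iff_range_in_kernel:
  fixes A B :: "'a::comm_ring_1 mat"
  assumes "A \<in> carrier_mat n k" "B \<in> carrier_mat k l"
  shows "A * B = 0\<^sub>m n l \<longleftrightarrow> (\<forall>c<l. col B c \<in> mat_kernel A)"
proof -
  have "A * B = 0\<^sub>m n l \<longleftrightarrow> (\<forall>c<l. col (A * B) c = 0\<^sub>v n)"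
  proof
    assume "\<forall>c<l. col (A * B) c = 0\<^sub>v n"
    then show "A * B = 0\<^sub>m n l" using assms by (intro mat_col_eqI) (auto simp del: col_mult)
  qed (auto simp del: col_mult)
  also have "\<dots> \<longleftrightarrow> (\<forall>c<l. A *\<^sub>v col B c = 0\<^sub>v n)"
    using assms by (auto simp: col_mult2[of A n k B l] simp del: col_mult)
  also have "\<dots> \<longleftrightarrow> (\<forall>c<l. col B c \<in> mat_kernel A)"
    using assms by (auto simp: mat_kernel)
  finally show ?thesis .
qed

lemma resolution_composite_zero:
  fixes A :: "nat \<Rightarrow> ('v, 'k::field) mpoly mat"
  assumes "graded_free_resolution d A I"
  shows "A i * A (Suc i) = 0\<^sub>m (length (target_degrees d i)) (length (d (Suc i)))"
proof -
  note car = graded_free_resolutionD(1)[OF assms, THEN homogeneous_matrix_carrier]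
  show ?thesis
    using mult_eq_0_iff_range_in_kernel[OF car[of i] car[of "Suc i"]] car[of "Suc i"]
      graded_free_resolutionD(3)[OF assms, of i] col_in_mat_range[of _ "A (Suc i)"] by auto
qed

text \<open>
  The comparison theorem for free resolutions: the maps are lifted one step at a time, because the
  columns of \<open>P i * A i\<close> are cycles of the second complex, hence boundaries; at the start they lie in the
  range of \<open>A' 0\<close> because both complexes resolve the same ideal.  The index \<open>0\<close> is the
  ring itself, on which the comparison is the identity.
\<close>

lemma comparison_maps:
  fixes A A' :: "nat \<Rightarrow> ('v, 'k::field) mpoly mat"
  assumes res: "graded_free_resolution d A I" and res': "graded_free_resolution d' A' I"
  obtains P where "P 0 = 1\<^sub>m 1"
    and "\<And>i. homogeneous_matrix (target_degrees d' i) (target_degrees d i) (P i)"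
    and "\<And>i. A' i * P (Suc i) = P i * A i"
proof -
  let ?t = "target_degrees d" and ?t' = "target_degrees d'"
  note hom = graded_free_resolutionD(1)[OF res] and hom' = graded_free_resolutionD(1)[OF res']
  note car = hom[THEN homogeneous_matrix_carrier] and car' = hom'[THEN homogeneous_matrix_carrier]
  \<comment> \<open>The range condition is the invariant that makes the next lift possible.\<close>
  define good where "good = (\<lambda>i P. homogeneous_matrix (?t' i) (?t i) P
      \<and> (i = 0 \<longrightarrow> P = 1\<^sub>m 1)
      \<and> (\<forall>c < length (?t (Suc i)). col (P * A i) c \<in> mat_range (A' i)))"
  have start: "good 0 (1\<^sub>m 1)"
  proof -
    have "col (A 0) c \<in> mat_range (A' 0)" if c: "c < length (d 0)" for c
    proof -
      have "col (A 0) c $ 0 \<in> I"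
        unfolding graded_free_resolutionD(2)[OF res] using c car[of 0] by (intro imageI col_in_mat_range) auto
      then obtain u where u: "u \<in> mat_range (A' 0)" "col (A 0) c $ 0 = u $ 0"
        unfolding graded_free_resolutionD(2)[OF res'] by auto
      have "u \<in> carrier_vec 1" using u(1) car'[of 0] by (auto simp: mat_range_def)
      then have "col (A 0) c = u"
        using u(2) car[of 0] c by (intro eq_vecI) auto
      then show ?thesis using u by simp
    qed
    then show ?thesis
      using car[of 0] by (auto simp: good_def homogeneous_matrix_def)
  qed
  have step: "\<exists>Y. good (Suc i) Y \<and> A' i * Y = X * A i" if X: "good i X" for i X
  proof -
    have homX: "homogeneous_matrix (?t' i) (?t i) X" using X by (simp add: good_def)
    note carX = homogeneous_matrix_carrier[OF homX]
    obtain Y where Y: "homogeneous_matrix (?t' (Suc i)) (?t (Suc i)) Y" "A' i * Y = X * A i"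
      using homogeneous_lift[OF hom' homogeneous_matrix_mult[OF homX hom]] X unfolding good_def by blast
    note carY = homogeneous_matrix_carrier[OF Y(1)]
    have "A' i * (Y * A (Suc i)) = (A' i * Y) * A (Suc i)"
      using car'[of i] carY car[of "Suc i"] by (rule assoc_mult_mat[symmetric])
    also have "\<dots> = X * (A i * A (Suc i))"
      unfolding Y(2) using carX car[of i] car[of "Suc i"] by (rule assoc_mult_mat)
    also have "\<dots> = 0\<^sub>m (length (?t' i)) (length (?t (Suc (Suc i))))"
      using carX by (simp add: resolution_composite_zero[OF res])
    finally have "\<forall>c<length (?t (Suc (Suc i))). col (Y * A (Suc i)) c \<in> mat_kernel (A' i)"
      using mult_eq_0_iff_range_in_kernel[OF car'[of i] mult_carrier_mat[OF carY car[of "Suc i"]]] by blast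
    then show ?thesis
      using Y unfolding good_def graded_free_resolutionD(3)[OF res'] by auto
  qed
  obtain P where "\<And>i. good i (P i)" "\<And>i. A' i * P (Suc i) = P i * A i"
    using dependent_nat_choice[of good "\<lambda>i X Y. A' i * Y = X * A i"] start step by metis
  then show ?thesis
    using that[of P] unfolding good_def by blast
qed

text \<open>
  An endomorphism \<open>T\<close> of the complex that lifts the identity is homotopic to the identity, that is,
  \<open>T (Suc i) - 1 = A (Suc i) * K + H * A i\<close>.  In a minimal resolution the entries of the differentials
  have no constant term, so the difference vanishes after reduction.
\<close>

lemma endomorphism_of_minimal_resolution_const:
  fixes A T :: "nat \<Rightarrow> ('v, 'k::field) mpoly mat"
  assumes min: "minimal_graded_free_resolution d A I"
    and T0: "T 0 = 1\<^sub>m 1"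
    and carT: "\<And>i. T i \<in> carrier_mat (length (target_degrees d i)) (length (target_degrees d i))"
    and chain: "\<And>i. A i * T (Suc i) = T i * A i"
  shows "const_matrix (T (Suc i)) = 1\<^sub>m (length (d i))"
proof -
  have res: "graded_free_resolution d A I"
    using min by (simp add: minimal_graded_free_resolution_def)
  define n where "n = (\<lambda>i. length (target_degrees d i))"
  have car: "A i \<in> carrier_mat (n i) (n (Suc i))" for i
    using graded_free_resolutionD(1)[OF res] unfolding n_def by (rule homogeneous_matrix_carrier)
  define D where "D = (\<lambda>i. T i - 1\<^sub>m (n i))"
  have carT': "T i \<in> carrier_mat (n i) (n i)" for i using carT by (simp add: n_def)
  have carD: "D i \<in> carrier_mat (n i) (n i)" for i using carT' by (simp add: D_def minus_carrier_mat)
  have chainD: "A i * D (Suc i) = D i * A i" for i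
    using mult_minus_distrib_mat[OF car carT' one_carrier_mat]
      minus_mult_distrib_mat[OF carT' one_carrier_mat car] chain[of i] car[of i]
    by (simp add: D_def)
  have AA: "A i * A (Suc i) = 0\<^sub>m (n i) (n (Suc (Suc i)))" for i
    using resolution_composite_zero[OF res] by (simp add: n_def)
  have lift: "\<exists>K. K \<in> carrier_mat (n (Suc (Suc i))) (n (Suc i)) \<and> D (Suc i) = A (Suc i) * K + H * A i"
    if H: "H \<in> carrier_mat (n (Suc i)) (n i)" and eq: "A i * D (Suc i) = A i * H * A i" for H i
  proof -
    let ?B = "D (Suc i) - H * A i"
    have HA: "H * A i \<in> carrier_mat (n (Suc i)) (n (Suc i))" using H car by auto
    have B: "?B \<in> carrier_mat (n (Suc i)) (n (Suc i))" using HA by (simp add: minus_carrier_mat)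
    have "A i * ?B = 0\<^sub>m (n i) (n (Suc i))"
      using mult_minus_distrib_mat[OF car carD HA] eq assoc_mult_mat[OF car H car] carD[of "Suc i"] car[of i] HA
      by (auto simp: n_def)
    then have range: "\<forall>c<n (Suc i). col ?B c \<in> mat_range (A (Suc i))"
      using mult_eq_0_iff_range_in_kernel[OF car B] graded_free_resolutionD(3)[OF res] by simp
    then have "\<forall>c\<in>{..<n (Suc i)}. \<exists>v. v \<in> carrier_vec (n (Suc (Suc i))) \<and> col ?B c = A (Suc i) *\<^sub>v v"
      using car[of "Suc i"] unfolding mat_range_def by fastforce
    then obtain v where v: "\<And>c. c < n (Suc i) \<Longrightarrow> v c \<in> carrier_vec (n (Suc (Suc i)))"
        "\<And>c. c < n (Suc i) \<Longrightarrow> col ?B c = A (Suc i) *\<^sub>v v c"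
      by (metis lessThan_iff)
    define K where "K = mat_of_cols (n (Suc (Suc i))) (map v [0..<n (Suc i)])"
    have K: "K \<in> carrier_mat (n (Suc (Suc i))) (n (Suc i))"
      using mat_of_cols_carrier(1)[of "n (Suc (Suc i))" "map v [0..<n (Suc i)]"] by (simp add: K_def)
    have "A (Suc i) * K = ?B"
    proof (rule mat_col_eqI)
      fix c assume "c < dim_col ?B"
      then have c: "c < n (Suc i)" using carrier_matD(2)[OF B] by metis
      have "col K c = v c" unfolding K_def using c v(1) by (subst col_mat_of_cols) auto
      then show "col (A (Suc i) * K) c = col ?B c"
        using c v(2) col_mult2[OF car K c] by simp
    qed (use K B car[of "Suc i"] in auto)
    then have "A (Suc i) * K + H * A i = D (Suc i)"
      using carD[of "Suc i"] HA by (simp add: minus_add_uminus_mat[of _ "n (Suc i)" "n (Suc i)"]) 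
    then show ?thesis using K by metis
  qed
  \<comment> \<open>Only the equation after multiplication with \<open>A i\<close> is carried through the induction, so that no
     homotopy has to be fixed in advance.  In the lowest degree the homotopy is \<open>0\<close>; this matters below,
     because the entries of \<open>A 0\<close>, the generators of the ideal, may have constant terms.\<close>
  have homotopy: "\<exists>H \<in> carrier_mat (n (Suc i)) (n i). A i * D (Suc i) = A i * H * A i \<and> (i = 0 \<longrightarrow> H = 0\<^sub>m (n 1) 1)" for i
  proof (induction i)
    case 0
    have "D 0 = 0\<^sub>m 1 1"
      unfolding D_def n_def T0 using minus_r_inv_mat[OF one_carrier_mat] by simp
    then have "A 0 * D (Suc 0) = 0\<^sub>m 1 1 * A 0"
      using chainD[of 0] by simp
    then show ?case
      using car[of 0] by (intro bexI[of _ "0\<^sub>m (n 1) 1"]) (auto simp: n_def)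
  next
    case (Suc i)
    then obtain H where H: "H \<in> carrier_mat (n (Suc i)) (n i)" "A i * D (Suc i) = A i * H * A i" by blast
    obtain K where K: "K \<in> carrier_mat (n (Suc (Suc i))) (n (Suc i))" "D (Suc i) = A (Suc i) * K + H * A i"
      using lift[OF H] by blast
    have "A (Suc i) * D (Suc (Suc i)) = (A (Suc i) * K + H * A i) * A (Suc i)"
      using chainD K(2) by simp
    also have "\<dots> = A (Suc i) * K * A (Suc i) + H * A i * A (Suc i)"
      using add_mult_distrib_mat[OF mult_carrier_mat[OF car K(1)] mult_carrier_mat[OF H(1) car] car] .
    also have "H * A i * A (Suc i) = 0\<^sub>m (n (Suc i)) (n (Suc (Suc i)))"
      using assoc_mult_mat[OF H(1) car car] AA[of i] H(1) by simp
    finally show ?case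
      using K(1) car[of "Suc i"] mult_carrier_mat[OF mult_carrier_mat[OF car K(1)] car] by auto
  qed
  obtain H where H: "H \<in> carrier_mat (n (Suc i)) (n i)" "A i * D (Suc i) = A i * H * A i" "i = 0 \<longrightarrow> H = 0\<^sub>m (n 1) 1"
    using homotopy by blast
  obtain K where K: "K \<in> carrier_mat (n (Suc (Suc i))) (n (Suc i))" "D (Suc i) = A (Suc i) * K + H * A i"
    using lift[OF H(1,2)] by blast
  have const_A: "Poly_Mapping.lookup (A (Suc i) $$ (r, c)) 0 = 0" if "r < n (Suc i)" "c < n (Suc (Suc i))" for i r c
    using min that by (simp add: minimal_graded_free_resolution_def n_def)
  have "Poly_Mapping.lookup (D (Suc i) $$ (r, c)) 0 = 0" if rc: "r < n (Suc i)" "c < n (Suc i)" for r c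
  proof -
    have "Poly_Mapping.lookup ((A (Suc i) * K) $$ (r, c)) 0 = 0"
      unfolding index_mult_mat_sum[OF car K(1) rc] using rc
      by (simp add: lookup_sum const_coeff_times const_A)
    moreover have "Poly_Mapping.lookup ((H * A i) $$ (r, c)) 0 = 0"
    proof (cases i)
      case 0
      then show ?thesis using H(3) car[of 0] rc by (simp add: n_def)
    next
      case (Suc j)
      then show ?thesis
        unfolding index_mult_mat_sum[OF H(1) car rc] using rc
        by (simp add: lookup_sum const_coeff_times const_A)
    qed
    ultimately show ?thesis
      unfolding K(2) using rc H(1) car[of i] by (simp add: lookup_add)
  qed
  then show ?thesis
    using carT'[of "Suc i"] unfolding D_def const_matrix_def n_def
    by (intro eq_matI) (force simp: lookup_minus lookup_one split: if_splits)+
qed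

text \<open>
  Both composites of the comparison maps \<open>P\<close> and \<open>Q\<close> between two minimal resolutions reduce to
  identity matrices, so that in each degree the two bases have the same number of elements.
\<close>

lemma minimal_resolution_degrees_unique:
  fixes A A' :: "nat \<Rightarrow> ('v, 'k::field) mpoly mat"
  assumes min: "minimal_graded_free_resolution d A I" and min': "minimal_graded_free_resolution d' A' I"
  shows "count_list (d i) j = count_list (d' i) j"
proof -
  have le: "count_list (d i) j \<le> count_list (d' i) j"
    if min: "minimal_graded_free_resolution d A I" and min': "minimal_graded_free_resolution d' A' I"
    for d d' and A A' :: "nat \<Rightarrow> ('v, 'k) mpoly mat"
  proof -
    have res: "graded_free_resolution d A I" "graded_free_resolution d' A' I"
      using min min' by (auto simp: minimal_graded_free_resolution_def)
    obtain P where P: "P 0 = 1\<^sub>m 1" "\<And>i. homogeneous_matrix (target_degrees d' i) (target_degrees d i) (P i)"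
        "\<And>i. A' i * P (Suc i) = P i * A i"
      using comparison_maps[OF res] by blast
    obtain Q where Q: "Q 0 = 1\<^sub>m 1" "\<And>i. homogeneous_matrix (target_degrees d i) (target_degrees d' i) (Q i)"
        "\<And>i. A i * Q (Suc i) = Q i * A' i"
      using comparison_maps[OF res(2,1)] by blast
    note car = graded_free_resolutionD(1)[OF res(1), THEN homogeneous_matrix_carrier]
      and car' = graded_free_resolutionD(1)[OF res(2), THEN homogeneous_matrix_carrier]
      and carP = P(2)[THEN homogeneous_matrix_carrier] and carQ = Q(2)[THEN homogeneous_matrix_carrier]
    have "const_matrix (Q (Suc i) * P (Suc i)) = 1\<^sub>m (length (d i))"
    proof (rule endomorphism_of_minimal_resolution_const[OF min])
      fix i
      have "A i * (Q (Suc i) * P (Suc i)) = (Q i * A' i) * P (Suc i)"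
        using assoc_mult_mat[OF car carQ carP] Q(3) by metis
      also have "\<dots> = Q i * (P i * A i)"
        using assoc_mult_mat[OF carQ car' carP] P(3) by metis
      also have "\<dots> = (Q i * P i) * A i"
        using assoc_mult_mat[OF carQ carP car] by metis
      finally show "A i * (Q (Suc i) * P (Suc i)) = Q i * P i * A i" .
      show "Q i * P i \<in> carrier_mat (length (target_degrees d i)) (length (target_degrees d i))"
        using mult_carrier_mat[OF carQ carP] .
    qed (simp add: P(1) Q(1))
    then show ?thesis
      using degree_counts_le[OF Q(2)[of "Suc i"] P(2)[of "Suc i"]] by simp
  qed
  show ?thesis
    using le[OF min min'] le[OF min' min] by simp
qed

lemma graded_betti_eq:
  assumes "minimal_graded_free_resolution d A (I :: ('v, 'k::field) mpoly set)"
  shows "graded_betti I i j = count_list (d i) j"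
  unfolding graded_betti_def
  using assms minimal_resolution_degrees_unique by (intro the_equality) blast+

section \<open>The Taylor complex of a family of monomials\<close>

text \<open>
  Divisibility of monomials, to be distinguished from the lexicographic order \<open>\<le>\<close> on exponent vectors.
\<close>

definition exp_le :: "('v \<Rightarrow>\<^sub>0 nat) \<Rightarrow> ('v \<Rightarrow>\<^sub>0 nat) \<Rightarrow> bool" where
  "exp_le a b \<longleftrightarrow> (\<forall>x. Poly_Mapping.lookup a x \<le> Poly_Mapping.lookup b x)"

lemma lookup_exponent_diff:
  fixes a b :: "'v \<Rightarrow>\<^sub>0 nat"
  shows "Poly_Mapping.lookup (a - b) x = Poly_Mapping.lookup a x - Poly_Mapping.lookup b x"
  by (simp add: minus_poly_mapping.rep_eq)

lemma exp_le_diff_add: "exp_le a b \<Longrightarrow> b - a + a = b"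
  by (rule poly_mapping_eqI) (simp add: exp_le_def lookup_add lookup_exponent_diff)

lemma exp_le_add: "exp_le a (b + a)"
  by (simp add: exp_le_def lookup_add)

lemma exp_le_trans: "exp_le a b \<Longrightarrow> exp_le b c \<Longrightarrow> exp_le a c"
  by (meson exp_le_def order_trans)

text \<open>
  The sign with which \<open>U\<close> occurs in the simplicial boundary of \<open>insert v U\<close>.
\<close>

definition face_sign :: "nat \<Rightarrow> nat set \<Rightarrow> 'k::comm_ring_1" where
  "face_sign v U = (-1) ^ card {u \<in> U. u < v}"

lemma face_sign_insert:
  assumes "finite U" "u \<notin> U"
  shows "face_sign v (insert u U) = (if u < v then - face_sign v U else face_sign v U)"
proof -
  have "{x \<in> insert u U. x < v} = (if u < v then insert u {x \<in> U. x < v} else {x \<in> U. x < v})"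
    by auto
  then show ?thesis
    using assms by (simp add: face_sign_def)
qed

lemma face_sign_eq_1: "(\<And>u. u \<in> U \<Longrightarrow> v \<le> u) \<Longrightarrow> face_sign v U = 1"
proof -
  assume "\<And>u. u \<in> U \<Longrightarrow> v \<le> u"
  then have "{u \<in> U. u < v} = {}" by force
  then show ?thesis unfolding face_sign_def by (simp only: card.empty power_0)
qed

text \<open>
  The terms cancel in pairs; this is valid in every characteristic, because the diagonal does not
  occur in the sum.
\<close>

lemma sum_antisymmetric:
  fixes c :: "nat \<Rightarrow> nat \<Rightarrow> 'k::ab_group_add"
  assumes "finite W" and anti: "\<And>u v. u \<in> W \<Longrightarrow> v \<in> W \<Longrightarrow> u < v \<Longrightarrow> c v u = - c u v"
  shows "(\<Sum>v\<in>W. \<Sum>u\<in>W - {v}. c v u) = 0"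
proof -
  have "(\<Sum>u\<in>W - {v}. c v u) = (\<Sum>u\<in>W. if u < v then c v u else 0) + (\<Sum>u\<in>W. if v < u then c v u else 0)" for v
    using assms(1) unfolding sum.distrib[symmetric] by (intro sum.mono_neutral_cong_left) auto
  then have "(\<Sum>v\<in>W. \<Sum>u\<in>W - {v}. c v u)
      = (\<Sum>v\<in>W. \<Sum>u\<in>W. if u < v then c v u else 0) + (\<Sum>v\<in>W. \<Sum>u\<in>W. if v < u then c v u else 0)"
    by (simp add: sum.distrib)
  also have "(\<Sum>v\<in>W. \<Sum>u\<in>W. if v < u then c v u else 0) = (\<Sum>u\<in>W. \<Sum>v\<in>W. if v < u then c v u else 0)"
    by (rule sum.swap)
  also have "\<dots> = (\<Sum>u\<in>W. \<Sum>v\<in>W. if v < u then - c u v else 0)"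
  proof (intro sum.cong refl)
    fix u v assume "u \<in> W" "v \<in> W"
    then show "(if v < u then c v u else 0) = (if v < u then - c u v else 0)"
      using anti[of v u] by auto
  qed
  also have "\<dots> = - (\<Sum>v\<in>W. \<Sum>u\<in>W. if u < v then c v u else 0)"
    unfolding sum_negf[symmetric] by (intro sum.cong refl) auto
  finally show ?thesis by simp
qed

text \<open>
  The generators are the monomials with the exponent vectors \<open>g 0, \<dots>, g (m - 1)\<close>.  Indices in \<open>nat\<close>
  provide the linear order that the signs of the differential refer to.
\<close>

locale taylor_complex =
  fixes g :: "nat \<Rightarrow> ('v::finite \<Rightarrow>\<^sub>0 nat)" and m :: nat
begin

definition lcm_exp :: "nat set \<Rightarrow> ('v \<Rightarrow>\<^sub>0 nat)" where
  "lcm_exp T = Abs_poly_mapping (\<lambda>x. Max (insert 0 ((\<lambda>i. Poly_Mapping.lookup (g i) x) ` T)))"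

lemma lookup_lcm_exp:
  "Poly_Mapping.lookup (lcm_exp T) x = Max (insert 0 ((\<lambda>i. Poly_Mapping.lookup (g i) x) ` T))"
  by (simp add: lcm_exp_def)

lemma lcm_exp_le_iff: "finite T \<Longrightarrow> exp_le (lcm_exp T) a \<longleftrightarrow> (\<forall>i\<in>T. exp_le (g i) a)"
  by (auto simp: exp_le_def lookup_lcm_exp)

lemma lcm_exp_mono: "finite T \<Longrightarrow> U \<subseteq> T \<Longrightarrow> exp_le (lcm_exp U) (lcm_exp T)"
  using lcm_exp_le_iff[of T "lcm_exp T"] lcm_exp_le_iff[of U "lcm_exp T"] finite_subset[of U T]
  by (auto simp: exp_le_def)

lemma lcm_exp_empty [simp]: "lcm_exp {} = 0"
  by (rule poly_mapping_eqI) (simp add: lookup_lcm_exp)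

lemma lcm_exp_singleton [simp]: "lcm_exp {i} = g i"
  by (rule poly_mapping_eqI) (simp add: lookup_lcm_exp)

text \<open>
  An arbitrary enumeration, which assigns the rows and columns of the matrices to sets of generators.
\<close>

definition faces :: "nat \<Rightarrow> nat set list" where
  "faces i = (SOME xs. distinct xs \<and> set xs = {T. T \<subseteq> {..<m} \<and> card T = i})"

lemma distinct_faces: "distinct (faces i)"
  and set_faces: "set (faces i) = {T. T \<subseteq> {..<m} \<and> card T = i}"
proof -
  have "finite {T. T \<subseteq> {..<m} \<and> card T = i}"
    by (rule finite_subset[of _ "Pow {..<m}"]) auto
  then obtain xs where "distinct xs \<and> set xs = {T. T \<subseteq> {..<m} \<and> card T = i}"
    using finite_distinct_list by metis
  then have "distinct (faces i) \<and> set (faces i) = {T. T \<subseteq> {..<m} \<and> card T = i}"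
    unfolding faces_def by (rule someI)
  then show "distinct (faces i)" "set (faces i) = {T. T \<subseteq> {..<m} \<and> card T = i}" by auto
qed

lemma faces_0: "faces 0 = [{}]"
proof -
  have "set (faces 0) = {{}}" by (auto simp: set_faces card_eq_0_iff finite_subset)
  then show ?thesis
    using distinct_faces[of 0] by (cases "faces 0") (auto simp: subset_singleton_iff)
qed

lemma faces_nth: "c < length (faces i) \<Longrightarrow> faces i ! c \<subseteq> {..<m} \<and> card (faces i ! c) = i"
  using nth_mem[of c "faces i"] by (simp add: set_faces)

definition taylor_entry :: "nat set \<Rightarrow> nat set \<Rightarrow> ('v, 'k::comm_ring_1) mpoly" where
  "taylor_entry U T = (if U \<subseteq> T \<and> card T = Suc (card U)
     then Poly_Mapping.single (lcm_exp T - lcm_exp U) (face_sign (the_elem (T - U)) U) else 0)"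

definition taylor_matrix :: "nat \<Rightarrow> ('v, 'k::comm_ring_1) mpoly mat" where
  "taylor_matrix i = mat (length (faces i)) (length (faces (Suc i)))
     (\<lambda>(r, c). taylor_entry (faces i ! r) (faces (Suc i) ! c))"

definition taylor_degrees :: "nat \<Rightarrow> nat list" where
  "taylor_degrees i = map (\<lambda>T. monom_degree (lcm_exp T)) (faces (Suc i))"

lemma target_degrees_taylor:
  "target_degrees taylor_degrees i = map (\<lambda>T. monom_degree (lcm_exp T)) (faces i)"
  by (cases i) (simp_all add: faces_0 taylor_degrees_def)

lemma taylor_entry_insert:
  assumes "finite U" "v \<notin> U"
  shows "taylor_entry U (insert v U)
    = Poly_Mapping.single (lcm_exp (insert v U) - lcm_exp U) (face_sign v U)"
proof -
  have "insert v U - U = {v}" using assms by auto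
  then show ?thesis using assms by (auto simp: taylor_entry_def)
qed

text \<open>
  The differential of the Taylor complex, for chains of all dimensions at once.  A chain is a function on
  faces (sets of generators), which avoids the positions of the faces in a list.
\<close>

definition taylor_boundary ::
    "(nat set \<Rightarrow> ('v, 'k::comm_ring_1) mpoly) \<Rightarrow> nat set \<Rightarrow> ('v, 'k) mpoly" where
  "taylor_boundary f U = (\<Sum>v\<in>{..<m} - U.
     Poly_Mapping.single (lcm_exp (insert v U) - lcm_exp U) (face_sign v U) * f (insert v U))"

definition chain_vec :: "nat \<Rightarrow> (nat set \<Rightarrow> ('v, 'k::comm_ring_1) mpoly) \<Rightarrow> ('v, 'k) mpoly vec" where
  "chain_vec i f = vec (length (faces i)) (\<lambda>c. f (faces i ! c))"

lemma chain_vec_carrier [simp]: "chain_vec i f \<in> carrier_vec (length (faces i))"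
  by (simp add: chain_vec_def)

lemma chain_vec_surj:
  assumes "x \<in> carrier_vec (length (faces i))"
  obtains f where "x = chain_vec i f"
proof -
  have inj: "inj_on ((!) (faces i)) {..<length (faces i)}"
    using distinct_faces by (simp add: inj_on_nth)
  have "x = chain_vec i (\<lambda>T. x $ inv_into {..<length (faces i)} ((!) (faces i)) T)"
    using assms inj by (intro eq_vecI) (auto simp: chain_vec_def)
  then show ?thesis using that by blast
qed

lemma chain_vec_eq_iff:
  "chain_vec i f = chain_vec i h \<longleftrightarrow> (\<forall>T. T \<subseteq> {..<m} \<and> card T = i \<longrightarrow> f T = h T)"
proof -
  have "chain_vec i f = chain_vec i h \<longleftrightarrow> (\<forall>T\<in>set (faces i). f T = h T)"
    by (auto simp: chain_vec_def vec_eq_iff all_set_conv_all_nth)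
  then show ?thesis by (auto simp: set_faces)
qed

lemma chain_vec_zero: "chain_vec i (\<lambda>_. 0) = 0\<^sub>v (length (faces i))"
  by (auto simp: chain_vec_def)

lemma taylor_matrix_carrier [simp]:
  "taylor_matrix i \<in> carrier_mat (length (faces i)) (length (faces (Suc i)))"
  by (simp add: taylor_matrix_def)

text \<open>
  In the row of \<open>U\<close> only the columns of the faces \<open>insert v U\<close> have nonzero entries.
\<close>

lemma taylor_matrix_mult:
  "taylor_matrix i *\<^sub>v chain_vec (Suc i) f = chain_vec i (taylor_boundary f)"
proof (rule eq_vecI)
  fix r assume "r < dim_vec (chain_vec i (taylor_boundary f))"
  then have r: "r < length (faces i)" by (simp add: chain_vec_def)
  define U where "U = faces i ! r"
  have U: "U \<subseteq> {..<m}" "card U = i" "finite U"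
    using faces_nth[OF r] by (auto simp: U_def finite_subset)
  have "(taylor_matrix i *\<^sub>v chain_vec (Suc i) f) $ r
      = (\<Sum>c<length (faces (Suc i)). taylor_entry U (faces (Suc i) ! c) * f (faces (Suc i) ! c))"
    using r by (simp add: taylor_matrix_def chain_vec_def scalar_prod_def U_def atLeast0LessThan)
  also have "\<dots> = (\<Sum>T\<in>set (faces (Suc i)). taylor_entry U T * f T)"
    using distinct_faces by (simp add: sum.distinct_set_conv_list sum_list_sum_nth atLeast0LessThan)
  also have "\<dots> = (\<Sum>T\<in>(\<lambda>v. insert v U) ` ({..<m} - U). taylor_entry U T * f T)"
  proof (rule sum.mono_neutral_right)
    show "(\<lambda>v. insert v U) ` ({..<m} - U) \<subseteq> set (faces (Suc i))"
      using U by (auto simp: set_faces)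
    show "\<forall>T\<in>set (faces (Suc i)) - (\<lambda>v. insert v U) ` ({..<m} - U). taylor_entry U T * f T = 0"
    proof
      fix T assume T: "T \<in> set (faces (Suc i)) - (\<lambda>v. insert v U) ` ({..<m} - U)"
      have "\<not> U \<subseteq> T"
      proof
        assume "U \<subseteq> T"
        have "card T = Suc (card U)" "T \<subseteq> {..<m}" using T U by (auto simp: set_faces)
        then have "card (T - U) = 1" using U \<open>U \<subseteq> T\<close> by (simp add: card_Diff_subset)
        then obtain v where "T - U = {v}" by (meson card_1_singletonE)
        then have "T = insert v U" "v \<in> {..<m} - U" using \<open>U \<subseteq> T\<close> \<open>T \<subseteq> {..<m}\<close> by auto
        then show False using T by auto
      qed
      then show "taylor_entry U T * f T = 0" by (simp add: taylor_entry_def)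
    qed
  qed simp
  also have "\<dots> = (\<Sum>v\<in>{..<m} - U. taylor_entry U (insert v U) * f (insert v U))"
    by (rule sum.reindex_cong[of "\<lambda>v. insert v U"]) (auto simp: inj_on_def)
  also have "\<dots> = taylor_boundary f U"
    unfolding taylor_boundary_def using U by (intro sum.cong) (auto simp: taylor_entry_insert)
  finally show "(taylor_matrix i *\<^sub>v chain_vec (Suc i) f) $ r = chain_vec i (taylor_boundary f) $ r"
    using r by (simp add: chain_vec_def U_def)
qed (simp add: taylor_matrix_def chain_vec_def)

text \<open>
  The part of a chain in the multidegree \<open>a\<close>.  The basis element of the face \<open>T\<close> has the multidegree
  \<open>lcm_exp T\<close>, so that this part has one scalar for each face \<open>T\<close> whose generators all divide the
  monomial \<open>a\<close>.
\<close>

definition strand :: "(nat set \<Rightarrow> ('v, 'k::comm_ring_1) mpoly) \<Rightarrow> ('v \<Rightarrow>\<^sub>0 nat) \<Rightarrow> nat set \<Rightarrow> 'k" where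
  "strand f a T = (if exp_le (lcm_exp T) a then Poly_Mapping.lookup (f T) (a - lcm_exp T) else 0)"

lemma strand_add_lcm: "strand f (b + lcm_exp T) T = Poly_Mapping.lookup (f T) b"
  by (simp add: strand_def exp_le_add)

lemma strand_eqD: "(\<And>a. strand f a T = strand h a T) \<Longrightarrow> f T = h T"
  by (rule poly_mapping_eqI) (metis strand_add_lcm)

lemma strand_zero [simp]: "strand (\<lambda>_. 0) a T = 0"
  by (simp add: strand_def)

text \<open>
  In each multidegree the Taylor differential is the boundary operator of a simplicial complex, with
  scalar coefficients \<open>1\<close> and \<open>-1\<close>: the monomial coefficients only shift between the basis elements.
\<close>

lemma strand_boundary:
  assumes "U \<subseteq> {..<m}"
  shows "strand (taylor_boundary f) a U = (\<Sum>v\<in>{..<m} - U. face_sign v U * strand f a (insert v U))"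
proof -
  have fin: "finite U" using assms finite_subset by blast
  have mono: "exp_le (lcm_exp U) (lcm_exp (insert v U))" for v
    using fin by (intro lcm_exp_mono) auto
  show ?thesis
  proof (cases "exp_le (lcm_exp U) a")
    case False
    then have "strand f a (insert v U) = 0" for v
      using mono[of v] exp_le_trans by (auto simp: strand_def)
    then show ?thesis using False by (simp add: strand_def)
  next
    case True
    have "Poly_Mapping.lookup (Poly_Mapping.single (lcm_exp (insert v U) - lcm_exp U) (face_sign v U) * f (insert v U))
        (a - lcm_exp U) = face_sign v U * strand f a (insert v U)" for v
    proof (cases "exp_le (lcm_exp (insert v U)) a")
      case le: True
      have "a - lcm_exp U = (lcm_exp (insert v U) - lcm_exp U) + (a - lcm_exp (insert v U))"
        using mono[of v] le
        by (intro poly_mapping_eqI) (simp add: lookup_add lookup_exponent_diff exp_le_def)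
      then show ?thesis
        by (simp only: lookup_single_times_add) (simp add: strand_def le)
    next
      case nle: False
      have "a - lcm_exp U \<noteq> (lcm_exp (insert v U) - lcm_exp U) + b" for b
      proof
        assume "a - lcm_exp U = (lcm_exp (insert v U) - lcm_exp U) + b"
        then have "a = b + lcm_exp (insert v U)"
          using exp_le_diff_add[OF True] exp_le_diff_add[OF mono[of v]]
          by (metis add.assoc add.commute)
        then show False using nle exp_le_add by blast
      qed
      then show ?thesis
        by (simp add: lookup_single_times_eq_0 strand_def nle)
    qed
    then show ?thesis
      using True by (simp add: strand_def[of "taylor_boundary f"] taylor_boundary_def lookup_sum)
  qed
qed

text \<open>
  Two vertices can be added to \<open>U\<close> in two orders, and these carry opposite signs.
\<close>

lemma taylor_boundary_boundary:
  assumes U: "U \<subseteq> {..<m}"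
  shows "taylor_boundary (taylor_boundary f) U = 0"
proof -
  have fin: "finite U" using assms finite_subset by blast
  let ?W = "{..<m} - U"
  have "strand (taylor_boundary (taylor_boundary f)) a U = 0" for a
  proof -
    let ?c = "\<lambda>v u. face_sign v U * (face_sign u (insert v U) * strand f a (insert u (insert v U)))"
    have "strand (taylor_boundary (taylor_boundary f)) a U = (\<Sum>v\<in>?W. \<Sum>u\<in>?W - {v}. ?c v u)"
      unfolding strand_boundary[OF U] sum_distrib_left[symmetric]
    proof (intro sum.cong refl arg_cong2[of _ _ _ _ times])
      fix v assume "v \<in> ?W"
      then have "insert v U \<subseteq> {..<m}" "{..<m} - insert v U = ?W - {v}" using U by auto
      then show "strand (taylor_boundary f) a (insert v U)
          = (\<Sum>u\<in>?W - {v}. face_sign u (insert v U) * strand f a (insert u (insert v U)))"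
        using strand_boundary by metis
    qed
    also have "\<dots> = 0"
    proof (rule sum_antisymmetric)
      fix u v assume "u \<in> ?W" "v \<in> ?W" "u < v"
      then show "?c v u = - ?c u v"
        using fin by (simp add: face_sign_insert insert_commute[of u v] mult_ac)
    qed simp
    finally show ?thesis .
  qed
  then show ?thesis
    using strand_eqD[of "taylor_boundary (taylor_boundary f)" U "\<lambda>_. 0"] by simp
qed

text \<open>
  The apex of the cone in the multidegree \<open>a\<close>.  It is well determined wherever a chain on nonempty faces
  can be nonzero, since there some generator divides \<open>a\<close>.
\<close>

definition least_divisor :: "('v \<Rightarrow>\<^sub>0 nat) \<Rightarrow> nat" where
  "least_divisor a = (LEAST v. v < m \<and> exp_le (g v) a)"

text \<open>
  In the multidegree \<open>a\<close> the simplicial complex is the full simplex on the generators that divide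
  \<open>a\<close>.  It is contracted by the cone over one of its vertices.  With the least vertex as the apex all
  signs of the cone are \<open>1\<close>.
\<close>

definition cone :: "(nat set \<Rightarrow> ('v, 'k::comm_ring_1) mpoly) \<Rightarrow> nat set \<Rightarrow> ('v, 'k) mpoly" where
  "cone f T = Abs_poly_mapping (\<lambda>b. if least_divisor (b + lcm_exp T) \<in> T
     then strand f (b + lcm_exp T) (T - {least_divisor (b + lcm_exp T)}) else 0)"

lemma strand_cone:
  assumes T: "finite T" and le: "exp_le (lcm_exp T) a"
  shows "strand (cone f) a T
    = (if least_divisor a \<in> T then strand f a (T - {least_divisor a}) else 0)"
proof -
  let ?h = "\<lambda>b. if least_divisor (b + lcm_exp T) \<in> T
     then strand f (b + lcm_exp T) (T - {least_divisor (b + lcm_exp T)}) else 0"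
  \<comment> \<open>The apex varies with the multidegree, but there are only finitely many candidates for it, and
     each of them gives only finitely many nonzero coefficients.\<close>
  have "{b. ?h b \<noteq> 0} \<subseteq> (\<Union>v\<in>T. (\<lambda>k. k + lcm_exp (T - {v}) - lcm_exp T) ` Poly_Mapping.keys (f (T - {v})))"
  proof
    fix b assume "b \<in> {b. ?h b \<noteq> 0}"
    then have h: "?h b \<noteq> 0" by simp
    define v where "v = least_divisor (b + lcm_exp T)"
    have v: "v \<in> T" "strand f (b + lcm_exp T) (T - {v}) \<noteq> 0"
      using h by (auto simp: v_def split: if_splits)
    define k where "k = b + lcm_exp T - lcm_exp (T - {v})"
    have k: "exp_le (lcm_exp (T - {v})) (b + lcm_exp T)" "k \<in> Poly_Mapping.keys (f (T - {v}))"
      using v(2) by (auto simp: strand_def in_keys_iff k_def split: if_splits)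
    have "b = k + lcm_exp (T - {v}) - lcm_exp T"
      unfolding k_def exp_le_diff_add[OF k(1)] by simp
    then show "b \<in> (\<Union>v\<in>T. (\<lambda>k. k + lcm_exp (T - {v}) - lcm_exp T) ` Poly_Mapping.keys (f (T - {v})))"
      using v(1) k(2) by blast
  qed
  then have "finite {b. ?h b \<noteq> 0}"
    by (rule finite_subset) (use T in auto)
  then have "Poly_Mapping.lookup (cone f T) b = ?h b" for b
    by (simp only: cone_def lookup_Abs_poly_mapping)
  then show ?thesis
    using le exp_le_diff_add[OF le] by (simp add: strand_def[of "cone f"])
qed

text \<open>
  The cone operator is a contracting homotopy: on a cycle its boundary is the cycle itself.
  The cycle is evaluated on the face \<open>T\<close>.  If the apex is not in \<open>T\<close>, only the cone with base \<open>T\<close>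
  contributes.  If it is, the cycle condition at the face of \<open>T\<close> opposite to the apex expresses the
  value on \<open>T\<close> by the values that occur in the boundary of the cone.
\<close>

lemma taylor_exact:
  fixes f :: "nat set \<Rightarrow> ('v, 'k::comm_ring_1) mpoly"
  assumes cycle: "\<And>U. U \<subseteq> {..<m} \<Longrightarrow> card U = i \<Longrightarrow> taylor_boundary f U = 0"
    and T: "T \<subseteq> {..<m}" "card T = Suc i"
  shows "taylor_boundary (cone f) T = f T"
proof (rule strand_eqD)
  fix a
  have fin: "finite T" using T finite_subset by blast
  show "strand (taylor_boundary (cone f)) a T = strand f a T"
  proof (cases "exp_le (lcm_exp T) a")
    case False
    then show ?thesis by (simp add: strand_def)
  next
    case True
    define z where "z = least_divisor a"
    have divs: "u < m \<and> exp_le (g u) a" if "u \<in> T" for u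
      using that T(1) True lcm_exp_le_iff[OF fin] by auto
    obtain t where "t \<in> T" using T(2) by fastforce
    then have z: "z < m" "exp_le (g z) a"
      using LeastI[of "\<lambda>v. v < m \<and> exp_le (g v) a" t] divs unfolding z_def least_divisor_def by auto
    have z_le: "z \<le> u" if "u < m" "exp_le (g u) a" for u
      using that unfolding z_def least_divisor_def by (intro Least_le) auto
    have cone: "strand (cone f) a (insert v T) = (if exp_le (g v) a \<and> z \<in> insert v T
        then strand f a (insert v T - {z}) else 0)" for v
    proof -
      have "exp_le (lcm_exp (insert v T)) a \<longleftrightarrow> exp_le (g v) a"
        using lcm_exp_le_iff[of "insert v T" a] fin divs by auto
      then show ?thesis
        using strand_cone[of "insert v T" a f] fin by (auto simp: z_def strand_def[of "cone f"])
    qed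
    show ?thesis
    proof (cases "z \<in> T")
      case False
      have "strand (taylor_boundary (cone f)) a T
          = (\<Sum>v\<in>{..<m} - T. if v = z then face_sign z T * strand f a T else 0)"
        unfolding strand_boundary[OF T(1)] using False z by (intro sum.cong) (auto simp: cone)
      also have "\<dots> = face_sign z T * strand f a T"
        using False z by simp
      also have "face_sign z T = (1 :: 'k)"
        using z_le divs by (intro face_sign_eq_1) auto
      finally show ?thesis by simp
    next
      case zT: True
      define U where "U = T - {z}"
      have U: "U \<subseteq> {..<m}" "card U = i" "finite U" "z \<notin> U" "insert z U = T"
        using T zT fin by (auto simp: U_def)
      have summand: "face_sign v T * strand (cone f) a (insert v T)
          = - (face_sign v U * strand f a (insert v U))" if v: "v \<in> {..<m} - T" for v
      proof (cases "exp_le (g v) a")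
        case True
        then have "z < v" using z_le[of v] v zT by (cases "z = v") auto
        moreover have "insert v T - {z} = insert v U" using v zT by (auto simp: U_def)
        moreover have "face_sign v T = (- face_sign v U :: 'k)"
          using face_sign_insert[OF U(3,4), of v] \<open>z < v\<close> U(5) by simp
        ultimately show ?thesis using True zT by (simp add: cone)
      next
        case False
        then have "strand f a (insert v U) = 0"
          using lcm_exp_le_iff[of "insert v U" a] U(3) by (simp add: strand_def)
        then show ?thesis using False by (simp add: cone)
      qed
      have "0 = strand (taylor_boundary f) a U"
        using cycle[OF U(1,2)] by (simp add: strand_def)
      also have "\<dots> = (\<Sum>v\<in>insert z ({..<m} - T). face_sign v U * strand f a (insert v U))"
        unfolding strand_boundary[OF U(1)] using zT z by (intro sum.cong) (auto simp: U_def)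
      also have "\<dots> = face_sign z U * strand f a T
          + (\<Sum>v\<in>{..<m} - T. face_sign v U * strand f a (insert v U))"
        using zT U(5) by simp
      also have "face_sign z U = (1 :: 'k)"
        using z_le divs by (intro face_sign_eq_1) (auto simp: U_def)
      finally have "strand f a T = - (\<Sum>v\<in>{..<m} - T. face_sign v U * strand f a (insert v U))"
        by (simp add: eq_neg_iff_add_eq_0)
      also have "\<dots> = strand (taylor_boundary (cone f)) a T"
        unfolding strand_boundary[OF T(1)] sum_negf[symmetric] using summand by (intro sum.cong) auto
      finally show ?thesis by simp
    qed
  qed
qed

lemma taylor_kernel_eq_range:
  "mat_kernel (taylor_matrix i :: ('v, 'k::comm_ring_1) mpoly mat) = mat_range (taylor_matrix (Suc i))"
proof
  show "mat_range (taylor_matrix (Suc i)) \<subseteq> mat_kernel (taylor_matrix i :: ('v, 'k) mpoly mat)"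
  proof
    fix y :: "('v, 'k) mpoly vec" assume "y \<in> mat_range (taylor_matrix (Suc i))"
    then obtain f where "y = taylor_matrix (Suc i) *\<^sub>v chain_vec (Suc (Suc i)) f"
      unfolding mat_range_def using chain_vec_surj carrier_matD(2)[OF taylor_matrix_carrier] by (smt (verit) mem_Collect_eq)
    then have y: "y = chain_vec (Suc i) (taylor_boundary f)" by (simp only: taylor_matrix_mult)
    have "chain_vec i (taylor_boundary (taylor_boundary f)) = chain_vec i (\<lambda>_. 0)"
      unfolding chain_vec_eq_iff using taylor_boundary_boundary by blast
    then show "y \<in> mat_kernel (taylor_matrix i)"
      unfolding y by (intro mat_kernelI[OF taylor_matrix_carrier]) (simp_all add: taylor_matrix_mult chain_vec_zero)
  qed
  show "mat_kernel (taylor_matrix i :: ('v, 'k) mpoly mat) \<subseteq> mat_range (taylor_matrix (Suc i))"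
  proof
    fix y :: "('v, 'k) mpoly vec" assume y: "y \<in> mat_kernel (taylor_matrix i)"
    obtain f where f: "y = chain_vec (Suc i) f"
      using mat_kernelD(1)[OF taylor_matrix_carrier y] chain_vec_surj by blast
    have "chain_vec i (taylor_boundary f) = chain_vec i (\<lambda>_. 0)"
      using mat_kernelD(2)[OF taylor_matrix_carrier y] by (simp add: f taylor_matrix_mult chain_vec_zero)
    then have "taylor_boundary f U = 0" if "U \<subseteq> {..<m}" "card U = i" for U
      using that unfolding chain_vec_eq_iff by blast
    then have "chain_vec (Suc i) (taylor_boundary (cone f)) = y"
      unfolding f chain_vec_eq_iff using taylor_exact by blast
    then have "y = taylor_matrix (Suc i) *\<^sub>v chain_vec (Suc (Suc i)) (cone f)"
      by (simp add: taylor_matrix_mult)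
    then show "y \<in> mat_range (taylor_matrix (Suc i))"
      unfolding mat_range_def using carrier_matD(2)[OF taylor_matrix_carrier] chain_vec_carrier by (smt (verit) mem_Collect_eq)
  qed
qed

text \<open>
  The empty face is the basis element of the ring itself, and the faces with one element are mapped
  to the generators.
\<close>

lemma taylor_augmentation_image:
  "module.span (*) {Poly_Mapping.single (g i) (1 :: 'k::comm_ring_1) | i. i < m}
    = {(taylor_matrix 0 *\<^sub>v x) $ 0 | x. x \<in> carrier_vec (length (faces 1))}"
  (is "module.span _ ?G = ?R")
proof -
  interpret S: module "(*) :: ('v, 'k) mpoly \<Rightarrow> _"
    by unfold_locales (simp_all add: algebra_simps)
  define comb where "comb = (\<lambda>f. \<Sum>i<m. Poly_Mapping.single (g i) (1 :: 'k) * f i)"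
  have R: "?R = range comb"
  proof -
    have entry: "(taylor_matrix 0 *\<^sub>v chain_vec 1 f) $ 0 = comb (\<lambda>i. f {i})"
      for f :: "nat set \<Rightarrow> ('v, 'k) mpoly"
      using taylor_matrix_mult[of 0 f]
      by (simp add: chain_vec_def faces_0 taylor_boundary_def face_sign_def comb_def)
    show ?thesis
    proof (intro equalityI subsetI)
      fix p assume "p \<in> ?R"
      then obtain x where x: "x \<in> carrier_vec (length (faces 1))" "p = (taylor_matrix 0 *\<^sub>v x) $ 0" by blast
      obtain f where "x = chain_vec 1 f" using chain_vec_surj[OF x(1)] by blast
      then show "p \<in> range comb"
        using x(2) entry[of f] by simp
    next
      fix p assume "p \<in> range comb"
      then obtain f where "p = comb f" by blast
      then have "p = (taylor_matrix 0 *\<^sub>v chain_vec 1 (\<lambda>T. f (the_elem T))) $ 0"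
        by (simp only: entry the_elem_eq)
      then show "p \<in> ?R" using chain_vec_carrier by blast
    qed
  qed
  have "S.span ?G \<subseteq> range comb"
  proof (rule S.span_minimal)
    show "?G \<subseteq> range comb"
    proof
      fix p assume "p \<in> ?G"
      then obtain j where j: "j < m" "p = Poly_Mapping.single (g j) 1" by blast
      have "comb (\<lambda>i. if i = j then 1 else 0) = (\<Sum>i<m. if i = j then Poly_Mapping.single (g j) 1 else 0)"
        unfolding comb_def by (intro sum.cong) auto
      also have "\<dots> = p" using j by simp
      finally show "p \<in> range comb" by (metis rangeI)
    qed
    show "S.subspace (range comb)"
    proof (rule S.subspaceI)
      have "comb (\<lambda>_. 0) = 0" by (simp add: comb_def)
      then show "0 \<in> range comb" by (metis rangeI)
    next
      fix p q assume "p \<in> range comb" "q \<in> range comb"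
      then obtain f h where "p = comb f" "q = comb h" by blast
      then have "comb (\<lambda>i. f i + h i) = p + q"
        by (simp add: comb_def distrib_left sum.distrib)
      then show "p + q \<in> range comb" by (metis rangeI)
    next
      fix c p assume "p \<in> range comb"
      then obtain f where "p = comb f" by blast
      then have "comb (\<lambda>i. c * f i) = c * p"
        by (simp only: comb_def sum_distrib_left mult.left_commute)
      then show "c * p \<in> range comb" by (metis rangeI)
    qed
  qed
  moreover have "comb f \<in> S.span ?G" for f
    unfolding comb_def
  proof (rule S.span_sum)
    fix i assume "i \<in> {..<m}"
    then have "f i * Poly_Mapping.single (g i) 1 \<in> S.span ?G"
      by (intro S.span_scale S.span_base) auto
    then show "Poly_Mapping.single (g i) 1 * f i \<in> S.span ?G" by (simp add: mult.commute)
  qed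
  ultimately show ?thesis unfolding R by blast
qed

text \<open>
  A nonzero entry of a matrix of the Taylor complex is, up to sign, the quotient of the least common
  multiples of two consecutive faces.  It is a constant only if the two coincide, which is what the
  hypothesis excludes.
\<close>

lemma taylor_resolution_minimal:
  assumes strict: "\<And>T v. T \<subseteq> {..<m} \<Longrightarrow> v \<in> T \<Longrightarrow> lcm_exp (T - {v}) \<noteq> lcm_exp T"
  shows "minimal_graded_free_resolution taylor_degrees (taylor_matrix :: nat \<Rightarrow> ('v, 'k::field) mpoly mat)
    (module.span (*) {Poly_Mapping.single (g i) 1 | i. i < m})"
proof -
  have keys: "U \<subseteq> T \<and> card T = Suc (card U) \<and> k = lcm_exp T - lcm_exp U"
    if "k \<in> Poly_Mapping.keys (taylor_entry U T :: ('v, 'k) mpoly)" for k U T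
    using that by (auto simp: taylor_entry_def split: if_splits)
  have degree: "monom_degree k + monom_degree (lcm_exp U) = monom_degree (lcm_exp T)"
    if "k \<in> Poly_Mapping.keys (taylor_entry U T :: ('v, 'k) mpoly)" for k U T
  proof -
    have "finite T" "U \<subseteq> T" using keys[OF that] card.infinite by fastforce+
    then have "k + lcm_exp U = lcm_exp T"
      using keys[OF that] exp_le_diff_add lcm_exp_mono by blast
    then show ?thesis by (metis monom_degree_add)
  qed
  have const: "Poly_Mapping.lookup (taylor_entry U T :: ('v, 'k) mpoly) 0 = 0" if T: "T \<subseteq> {..<m}" for U T
  proof (rule ccontr)
    assume "Poly_Mapping.lookup (taylor_entry U T :: ('v, 'k) mpoly) 0 \<noteq> 0"
    then have k: "(0 :: 'v \<Rightarrow>\<^sub>0 nat) \<in> Poly_Mapping.keys (taylor_entry U T :: ('v, 'k) mpoly)" by (simp add: in_keys_iff)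
    have fin: "finite T" using T finite_subset by blast
    then have "exp_le (lcm_exp U) (lcm_exp T)" using keys[OF k] lcm_exp_mono by blast
    then have eq: "lcm_exp U = lcm_exp T" using keys[OF k] exp_le_diff_add by fastforce
    have "finite U" using keys[OF k] fin finite_subset by blast
    then have "card (T - U) = 1" using keys[OF k] by (simp add: card_Diff_subset)
    then obtain v where "T - U = {v}" by (meson card_1_singletonE)
    then have "v \<in> T" "T - {v} = U" using keys[OF k] by auto
    then show False using strict[OF T, of v] eq by simp
  qed
  show ?thesis
    unfolding minimal_graded_free_resolution_def graded_free_resolution_def
  proof (intro conjI allI impI ballI)
    fix i
    show "(taylor_matrix i :: ('v, 'k) mpoly mat)
        \<in> carrier_mat (length (target_degrees taylor_degrees i)) (length (taylor_degrees i))"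
      by (simp add: target_degrees_taylor) (simp add: taylor_degrees_def)
    have "mat_kernel (taylor_matrix i :: ('v, 'k) mpoly mat) = mat_range (taylor_matrix (Suc i))"
      by (rule taylor_kernel_eq_range)
    then show "mat_kernel (taylor_matrix i :: ('v, 'k) mpoly mat)
        = {taylor_matrix (Suc i) *\<^sub>v v | v. v \<in> carrier_vec (length (taylor_degrees (Suc i)))}"
      by (simp add: mat_range_def taylor_degrees_def taylor_matrix_def)
  next
    show "module.span (*) {Poly_Mapping.single (g i) (1 :: 'k) | i. i < m}
        = {(taylor_matrix 0 *\<^sub>v v) $ 0 | v. v \<in> carrier_vec (length (taylor_degrees 0))}"
      unfolding taylor_augmentation_image by (simp add: taylor_degrees_def)
  next
    fix i r c k
    assume "r < length (target_degrees taylor_degrees i)" "c < length (taylor_degrees i)"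
      "k \<in> Poly_Mapping.keys ((taylor_matrix i :: ('v, 'k) mpoly mat) $$ (r, c))"
    then show "monom_degree k + target_degrees taylor_degrees i ! r = taylor_degrees i ! c"
      using degree by (simp add: target_degrees_taylor) (simp add: taylor_degrees_def taylor_matrix_def)
  next
    fix i r c assume "r < length (taylor_degrees i)" "c < length (taylor_degrees (Suc i))"
    then show "Poly_Mapping.lookup ((taylor_matrix (Suc i) :: ('v, 'k) mpoly mat) $$ (r, c)) 0 = 0"
      using const faces_nth by (simp add: taylor_degrees_def taylor_matrix_def)
  qed
qed

text \<open>
  A nonempty face \<open>T\<close> is a basis element in homological degree \<open>card T - 1\<close>, because the resolved module is
  the ideal and not its quotient ring.
\<close>

lemma regularity_taylor:
  assumes strict: "\<And>T v. T \<subseteq> {..<m} \<Longrightarrow> v \<in> T \<Longrightarrow> lcm_exp (T - {v}) \<noteq> lcm_exp T"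
  shows "regularity (module.span (*) {Poly_Mapping.single (g i) (1 :: 'k::field) | i. i < m})
    = Max ((\<lambda>T. int (monom_degree (lcm_exp T)) - int (card T) + 1) ` (Pow {..<m} - {{}}))"
proof -
  let ?I = "module.span (*) {Poly_Mapping.single (g i) (1 :: 'k) | i. i < m}"
  have betti: "graded_betti ?I i j = count_list (taylor_degrees i) j" for i j
    using taylor_resolution_minimal[OF strict] by (rule graded_betti_eq)
  have iff: "graded_betti ?I i j \<noteq> 0 \<longleftrightarrow> (\<exists>T\<subseteq>{..<m}. card T = Suc i \<and> monom_degree (lcm_exp T) = j)" for i j
    unfolding betti count_list_0_iff by (auto simp: taylor_degrees_def set_faces)
  have "{int j - int i | i j. graded_betti ?I i j \<noteq> 0}
      = (\<lambda>T. int (monom_degree (lcm_exp T)) - int (card T) + 1) ` (Pow {..<m} - {{}})"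
  proof (intro equalityI subsetI)
    fix x assume "x \<in> {int j - int i | i j. graded_betti ?I i j \<noteq> 0}"
    then obtain T i where "T \<subseteq> {..<m}" "card T = Suc i" "x = int (monom_degree (lcm_exp T)) - int i"
      unfolding iff by blast
    then show "x \<in> (\<lambda>T. int (monom_degree (lcm_exp T)) - int (card T) + 1) ` (Pow {..<m} - {{}})"
      by (intro image_eqI[of _ _ T]) auto
  next
    fix x assume "x \<in> (\<lambda>T. int (monom_degree (lcm_exp T)) - int (card T) + 1) ` (Pow {..<m} - {{}})"
    then obtain T where T: "T \<subseteq> {..<m}" "T \<noteq> {}" "x = int (monom_degree (lcm_exp T)) - int (card T) + 1" by blast
    then have "finite T" by (simp add: finite_subset)
    then obtain i where i: "card T = Suc i" using T(2) by (metis card_eq_0_iff not0_implies_Suc)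
    then have "x = int (monom_degree (lcm_exp T)) - int i" using T(3) by simp
    then show "x \<in> {int j - int i | i j. graded_betti ?I i j \<noteq> 0}"
      unfolding iff using T(1) i by blast
  qed
  then show ?thesis unfolding regularity_def by simp
qed

end

section \<open>Parents in rooted forests\<close>

text \<open>
  A parent of \<open>v\<close> must be the last vertex before \<open>v\<close> on a path from the root to \<open>v\<close>: outside the path
  it would prolong the path against the direction of its edge, and earlier on the path it would close
  a cycle.
\<close>

lemma rooted_forest_parent_unique:
  assumes forest: "rooted_forest E" and u: "(u, v) \<in> E" and u': "(u', v) \<in> E"
  shows "u = u'"
proof -
  obtain P where P: "partition_on UNIV P" "\<forall>(u, v) \<in> E. \<exists>C\<in>P. u \<in> C \<and> v \<in> C"
      "\<forall>C\<in>P. rooted_tree C (E \<inter> C \<times> C)"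
    using forest unfolding rooted_forest_def by blast
  obtain C where C: "C \<in> P" "u \<in> C" "v \<in> C" using P(2) u by blast
  obtain C' where C': "C' \<in> P" "u' \<in> C'" "v \<in> C'" using P(2) u' by blast
  have "C' = C" using partition_onD2[OF P(1)] C C' by (auto simp: disjoint_def)
  define F where "F = E \<inter> C \<times> C"
  have edges: "(u, v) \<in> F" "(u', v) \<in> F"
    using u u' C C' \<open>C' = C\<close> by (auto simp: F_def)
  have tree: "oriented_graph F" "undirected_tree C F"
    using P(3) C(1) by (auto simp: rooted_tree_def F_def)
  obtain r where r: "r \<in> C" "\<And>p. undirected_path F p \<Longrightarrow> hd p = r \<Longrightarrow> successively (\<lambda>u v. (u, v) \<in> F) p"
    using P(3) C(1) unfolding rooted_tree_def F_def by blast
  obtain p where p: "undirected_path F p" "hd p = r" "last p = v"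
    using tree(2) r(1) C(3) unfolding undirected_tree_def by blast
  have acyclic: "\<not> undirected_cycle F q" for q
    using tree(2) unfolding undirected_tree_def by blast
  have p': "p \<noteq> []" "distinct p" "successively (adjacent F) p"
    using p(1) by (auto simp: undirected_path_def)
  have penultimate: "\<exists>p1. p = p1 @ [x, v]" if x: "(x, v) \<in> F" for x
  proof -
    have vx: "adjacent F v x" "adjacent F x v" "(v, x) \<notin> F" "x \<noteq> v"
      using x tree(1) by (auto simp: adjacent_def oriented_graph_def)
    have "x \<in> set p"
    proof (rule ccontr)
      \<comment> \<open>Otherwise the path can be prolonged to \<open>x\<close>, along the edge \<open>(x, v)\<close> in the wrong direction.\<close>
      assume "x \<notin> set p"
      then have "undirected_path F (p @ [x])"
        using p' p(3) vx by (simp add: undirected_path_def successively_append_iff)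
      then have "successively (\<lambda>u v. (u, v) \<in> F) (p @ [x])"
        using r(2) p(2) p'(1) by simp
      then show False using p'(1) p(3) vx by (simp add: successively_append_iff)
    qed
    then obtain p1 p2 where p12: "p = p1 @ x # p2" by (meson split_list)
    have "p2 \<noteq> []" using p12 p(3) vx by auto
    then have last: "last p2 = v" using p12 p(3) by simp
    have "undirected_path F (x # p2)"
      using p' p12 by (auto simp: undirected_path_def successively_append_iff)
    then have "length (x # p2) < 3"
      using acyclic[of "x # p2"] vx last \<open>p2 \<noteq> []\<close> by (auto simp: undirected_cycle_def)
    then have "p2 = [v]" using last \<open>p2 \<noteq> []\<close> by (cases p2) auto
    then show ?thesis using p12 by blast
  qed
  show ?thesis
    using penultimate[OF edges(1)] penultimate[OF edges(2)] by auto
qed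

section \<open>Regularity of the edge ideal\<close>

lemma var_power: "var v ^ n = Poly_Mapping.single (Poly_Mapping.single v n) (1 :: 'k::comm_ring_1)"
proof (induction n)
  case (Suc n)
  then show ?case
    by (simp add: var_def mult_single flip: single_add)
qed simp

theorem theorem1p3:
  fixes E :: "('v::finite \<times> 'v) set" and w :: "'v \<Rightarrow> nat"
  assumes graph: "weighted_oriented_graph E w"
    and forest: "rooted_forest E"
    and no_isolated: "\<And>x. \<not> isolated E x"
    and source_weight: "\<And>x. source E x \<Longrightarrow> w x = 1"
    and weight: "\<And>x. \<not> source E x \<Longrightarrow> 2 \<le> w x"
  shows "regularity (edge_ideal E w :: ('v, 'k::field) mpoly set) =
           (\<Sum>x\<in>UNIV. int (w x)) - int (card E) + 1"
proof -
  define m where "m = card E"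
  obtain e where e: "bij_betw e {..<m} E"
    using ex_bij_betw_nat_finite[of E] by (auto simp: m_def atLeast0LessThan)
  define g where "g = (\<lambda>i. Poly_Mapping.single (fst (e i)) 1
      + Poly_Mapping.single (snd (e i)) (w (snd (e i))))"
  interpret taylor_complex g m .
  have eE: "e i \<in> E" if "i < m" for i
    using bij_betwE[OF e] that by simp
  \<comment> \<open>A generator is determined by the end point of its edge, since a vertex has only one parent.\<close>
  have inj: "i = j" if "i < m" "j < m" "snd (e i) = snd (e j)" for i j
  proof -
    have "fst (e i) = fst (e j)"
      using rooted_forest_parent_unique[OF forest, of "fst (e i)" "snd (e i)" "fst (e j)"] eE that
      by (metis prod.collapse)
    then show ?thesis
      using that bij_betw_imp_inj_on[OF e] by (auto simp: inj_on_def prod_eq_iff)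
  qed
  have no_loop: "fst (e i) \<noteq> snd (e i)" if "i < m" for i
    using graph eE[OF that] by (force simp: weighted_oriented_graph_def oriented_graph_def split: prod.splits)
  have target: "2 \<le> w (snd (e i))" if "i < m" for i
    using weight[of "snd (e i)"] eE[OF that] unfolding source_def by (metis prod.collapse)
  have lookup_g: "Poly_Mapping.lookup (g i) x
      = (if snd (e i) = x then w x else if fst (e i) = x then 1 else 0)" if "i < m" for i x
    using no_loop[OF that] by (auto simp: g_def lookup_add lookup_single when_def)
  have fin: "finite T" if "T \<subseteq> {..<m}" for T
    using that finite_subset by blast
  have le_1: "Poly_Mapping.lookup (lcm_exp T) x \<le> 1"
    if "T \<subseteq> {..<m}" "\<And>i. i \<in> T \<Longrightarrow> snd (e i) \<noteq> x" for T x
    unfolding lookup_lcm_exp using that fin[OF that(1)] by (auto simp: lookup_g subset_iff)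
  have eq_w: "Poly_Mapping.lookup (lcm_exp T) (snd (e i)) = w (snd (e i))" if "T \<subseteq> {..<m}" "i \<in> T" for T i
    unfolding lookup_lcm_exp
  proof (rule Max_eqI)
    have i: "i < m" using that by auto
    then have "Poly_Mapping.lookup (g i) (snd (e i)) = w (snd (e i))" by (simp add: lookup_g)
    then show "w (snd (e i)) \<in> insert 0 ((\<lambda>j. Poly_Mapping.lookup (g j) (snd (e i))) ` T)"
      using that(2) by force
    fix y assume "y \<in> insert 0 ((\<lambda>j. Poly_Mapping.lookup (g j) (snd (e i))) ` T)"
    then show "y \<le> w (snd (e i))"
      using target[OF i] that(1) by (auto simp: lookup_g subset_iff)
  qed (use fin[OF that(1)] in simp)
  \<comment> \<open>Only the edge that ends in a vertex contributes an exponent above \<open>1\<close> at this vertex, so that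
     dropping the edge makes the least common multiple strictly smaller.\<close>
  have strict: "lcm_exp (T - {i}) \<noteq> lcm_exp T" if T: "T \<subseteq> {..<m}" "i \<in> T" for T i
  proof
    assume eq: "lcm_exp (T - {i}) = lcm_exp T"
    have "Poly_Mapping.lookup (lcm_exp (T - {i})) (snd (e i)) \<le> 1"
      using T inj[of _ i] by (intro le_1) (auto simp: subset_iff)
    moreover have "2 \<le> Poly_Mapping.lookup (lcm_exp T) (snd (e i))"
      using eq_w[OF T] target[of i] T by auto
    ultimately show False using eq by simp
  qed
  have source_iff: "source E x \<longleftrightarrow> (\<forall>i<m. snd (e i) \<noteq> x)" for x
  proof -
    have "source E x \<longleftrightarrow> x \<notin> snd ` e ` {..<m}"
      unfolding bij_betw_imp_surj_on[OF e] by (force simp: source_def)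
    then show ?thesis by auto
  qed
  have full: "Poly_Mapping.lookup (lcm_exp {..<m}) x = w x" for x
  proof (cases "source E x")
    case False
    then show ?thesis using eq_w[of "{..<m}"] by (auto simp: source_iff)
  next
    case True
    then obtain y where "(x, y) \<in> E" using no_isolated[of x] by (auto simp: isolated_def source_def)
    then obtain i where i: "i < m" "e i = (x, y)"
      using bij_betw_imp_surj_on[OF e] by auto
    have "exp_le (g i) (lcm_exp {..<m})"
      using lcm_exp_le_iff[of "{..<m}" "lcm_exp {..<m}"] i by (auto simp: exp_le_def)
    then have "1 \<le> Poly_Mapping.lookup (lcm_exp {..<m}) x"
      using i lookup_g[of i x] no_loop[of i] by (auto simp: exp_le_def dest: spec[of _ x])
    moreover have "Poly_Mapping.lookup (lcm_exp {..<m}) x \<le> 1"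
      using True by (intro le_1) (auto simp: source_iff)
    ultimately show ?thesis using source_weight[OF True] by simp
  qed
  \<comment> \<open>Each edge outside \<open>T\<close> costs at least one unit of degree, namely at its end point.\<close>
  have bound: "monom_degree (lcm_exp T) + (m - card T) \<le> (\<Sum>x\<in>UNIV. w x)" if T: "T \<subseteq> {..<m}" for T
  proof -
    define X where "X = (\<lambda>i. snd (e i)) ` ({..<m} - T)"
    have "inj_on (\<lambda>i. snd (e i)) ({..<m} - T)" using inj by (auto simp: inj_on_def)
    then have card_X: "card X = m - card T"
      using T fin[OF T] by (simp add: X_def card_image card_Diff_subset)
    have "Poly_Mapping.lookup (lcm_exp T) x + (if x \<in> X then 1 else 0) \<le> w x" for x
    proof (cases "x \<in> X")
      case True
      then obtain j where j: "j < m" "j \<notin> T" "x = snd (e j)" by (auto simp: X_def)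
      then have "Poly_Mapping.lookup (lcm_exp T) x \<le> 1"
        using T inj[of _ j] by (intro le_1) (auto simp: subset_iff)
      then show ?thesis using target[OF j(1)] j True by simp
    next
      case False
      have "exp_le (lcm_exp T) (lcm_exp {..<m})" using T by (intro lcm_exp_mono) auto
      then show ?thesis using False full by (simp add: exp_le_def)
    qed
    then have "(\<Sum>x\<in>UNIV. Poly_Mapping.lookup (lcm_exp T) x + (if x \<in> X then 1 else 0)) \<le> (\<Sum>x\<in>UNIV. w x)"
      by (intro sum_mono) auto
    moreover have "(\<Sum>x\<in>UNIV. if x \<in> X then 1 else 0) = card X"
      by (simp add: sum.If_cases)
    ultimately show ?thesis
      unfolding sum.distrib card_X monom_degree_UNIV by simp
  qed
  have "edge_ideal E w = module.span (*) {Poly_Mapping.single (g i) (1 :: 'k) | i. i < m}"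
  proof -
    have "{var u * var v ^ w v | u v. (u, v) \<in> E}
        = (\<lambda>(u, v). var u * var v ^ w v :: ('v, 'k) mpoly) ` e ` {..<m}"
      unfolding bij_betw_imp_surj_on[OF e] by (auto simp: image_iff split: prod.splits)
    also have "\<dots> = {Poly_Mapping.single (g i) 1 | i. i < m}"
    proof -
      have "(case e i of (u, v) \<Rightarrow> var u * var v ^ w v) = Poly_Mapping.single (g i) (1 :: 'k)" for i
        unfolding case_prod_beta var_power by (simp add: var_def mult_single g_def)
      then show ?thesis by (auto simp: image_image)
    qed
    finally show ?thesis unfolding edge_ideal_def by (rule arg_cong)
  qed
  then have "regularity (edge_ideal E w :: ('v, 'k) mpoly set)
      = Max ((\<lambda>T. int (monom_degree (lcm_exp T)) - int (card T) + 1) ` (Pow {..<m} - {{}}))"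
    by (simp only: regularity_taylor[OF strict])
  also have "\<dots> = (\<Sum>x\<in>UNIV. int (w x)) - int (card E) + 1"
  proof (rule Max_eqI)
    have "E \<noteq> {}" using no_isolated by (auto simp: isolated_def)
    then have "{..<m} \<noteq> {}" by (simp add: m_def lessThan_empty_iff)
    moreover have "int (monom_degree (lcm_exp {..<m})) = (\<Sum>x\<in>UNIV. int (w x))"
      by (simp add: monom_degree_UNIV full)
    ultimately show "(\<Sum>x\<in>UNIV. int (w x)) - int (card E) + 1
        \<in> (\<lambda>T. int (monom_degree (lcm_exp T)) - int (card T) + 1) ` (Pow {..<m} - {{}})"
      by (intro image_eqI[of _ _ "{..<m}"]) (auto simp: m_def)
    fix y assume "y \<in> (\<lambda>T. int (monom_degree (lcm_exp T)) - int (card T) + 1) ` (Pow {..<m} - {{}})"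
    then obtain T where T: "T \<subseteq> {..<m}" "y = int (monom_degree (lcm_exp T)) - int (card T) + 1" by auto
    have "card T \<le> m" using card_mono[OF _ T(1)] by simp
    then have "int (monom_degree (lcm_exp T)) + (int m - int (card T)) \<le> int (\<Sum>x\<in>UNIV. w x)"
      using bound[OF T(1)] by linarith
    then show "y \<le> (\<Sum>x\<in>UNIV. int (w x)) - int (card E) + 1"
      using T(2) by (simp add: m_def)
  qed simp
  finally show ?thesis .
qed

end
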